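(* Let $U$, $\gamma$, $I$ be the small-amplitude $2\pi$-periodic wave profile and its parameters described in the context, parameterized by the amplitude $a$, and let $\delta^2\Lambda_{c,\gamma}$ be the quadratic form defined in the context. There exist $\gamma_0\in\left(1,\frac{\pi^2}{8}\right)$ and $C>0$ such that $$\delta^2\Lambda_{c,\gamma}\ \ge\ C\,\|v\|_{H^1_{\rm per}}^2$$ for every $\gamma\in(1,\gamma_0)$ and every $v\in H^1_{\rm per,zero}$ such that $\langle U',v\rangle_{L^2_{\rm per}}=0$, if $c\in(c_-,c_+)$, where $c_\pm$ are given by the asymptotic expansion (as $a\to0$) $$c_{\pm}=2\pm2a+\mathcal O(a^2),$$ and where $a$ determines $\gamma$ and $I$ through the expansions $\gamma=1+\frac18a^2+\mathcal O(a^4)$ and $I=\frac12a^2+\mathcal O(a^4)$.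
   Context: **Periodic wave.** Consider the modified reduced Ostrovsky equation $(u_t+\frac12u^2u_x)_x=u$. Its (normalized) travelling wave profiles $U(z)$ satisfy $$\frac{d}{dz}\left[\left(\gamma-\tfrac12U^2\right)\frac{dU}{dz}\right]+U=0 ,$$ and along solutions the quantity $I=\frac12(\gamma-\frac12U^2)^2(U')^2+\frac{\gamma}{2}U^2-\frac18U^4$ is constant. For $\gamma>1$ close to $1$, $U$ is the smooth, even, zero-mean, $2\pi$-periodic solution parameterized by the small amplitude parameter $a$: $$U(z)=a\cos z+\tfrac{3}{64}a^3\cos3z+\mathcal O(a^5),\quad \gamma=1+\tfrac18a^2+\mathcal O(a^4),\quad I=\tfrac12a^2+\mathcal O(a^4)\quad\text{as }a\to0.$$ For these waves $|U(z)|<\sqrt{2\gamma}$ and $|U'(z)|<1$ for all $z$, and $\gamma^2-2I>0$. **Function spaces.** The perturbations $v$ are $2\pi N$-periodic, where $N$ is a positive integer. $L^2_{\rm per}$ and $H^s_{\rm per}$ denote the corresponding spaces of $2\pi N$-periodic functions, with inner products and norms over one period; the subscript "zero" restricts to zero-mean functions. $\partial_z^{-1}v$ denotes the zero-mean antiderivative of a zero-mean periodic function $v$. **Quadratic form.** For $c\in\mathbb R$ and $v\in H^1_{\rm per,zero}$, $$\delta^2\Lambda_{c,\gamma}=\int\left[(\partial_z^{-1}v)^2-\left(\gamma-\tfrac12U^2\right)v^2-\frac{c\,v^2}{2(\gamma^2-2I)^{1/2}}+\frac{c\,v_z^2}{2(1-(U')^2)^{3/2}}\right]dz ,$$ with the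 integral over one period of $v$. This is the quadratic part in $v$ of $\Lambda_{c,\gamma}(U+v)-\Lambda_{c,\gamma}(U)$, where $\Lambda_{c,\gamma}=S_\gamma-cR_\Gamma$, $S_\gamma(u)=\int[(\partial_z^{-1}u)^2+\frac1{12}u^4-\gamma u^2]\,dz$, $R_\Gamma(u)=\int[(1-u_z^2)^{1/2}-\Gamma u^2]\,dz$, and $\Gamma=-\frac12(\gamma^2-2I)^{-1/2}$.
   Formalization: The constant C may depend on γ (and on the fixed number N of periods) instead of being chosen before γ; a C uniform in γ∈(1,γ0) is impossible: for v=cos z, orthogonal to U', the form tends to 0 as a→0 while the H¹ norm stays fixed. *)

theory Defs
  imports "HOL-Analysis.Analysis" "HOL-Library.Landau_Symbols"
begin

definition smooth :: "(real \<Rightarrow> real) \<Rightarrow> bool" where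
  "smooth f \<longleftrightarrow> (\<forall>k x. ((deriv ^^ k) f) differentiable (at x))"

definition periodic :: "real \<Rightarrow> (real \<Rightarrow> real) \<Rightarrow> bool" where
  "periodic T f \<longleftrightarrow> (\<forall>x. f (x + T) = f x)"


subsection \<open>Sobolev spaces of periodic functions\<close>

text \<open>Elements are represented by everywhere defined, \<open>T\<close>-periodic Borel functions; functions
  that agree almost everywhere represent the same element. Here \<open>T > 0\<close> throughout.\<close>

definition L2_per :: "real \<Rightarrow> (real \<Rightarrow> real) set" where
  "L2_per T = {v. periodic T v \<and> v \<in> borel_measurable borel \<and>
                  set_integrable lborel {0..T} (\<lambda>x. (v x)\<^sup>2)}"

definition L2_inner :: "real \<Rightarrow> (real \<Rightarrow> real) \<Rightarrow> (real \<Rightarrow> real) \<Rightarrow> real" where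
  "L2_inner T v w = (LBINT x:{0..T}. v x * w x)"

definition has_weak_deriv :: "real \<Rightarrow> (real \<Rightarrow> real) \<Rightarrow> (real \<Rightarrow> real) \<Rightarrow> bool" where
  "has_weak_deriv T v w \<longleftrightarrow> v \<in> L2_per T \<and> w \<in> L2_per T \<and>
     (\<forall>\<phi>. smooth \<phi> \<and> periodic T \<phi> \<longrightarrow> L2_inner T v (deriv \<phi>) = - L2_inner T w \<phi>)"

definition H1_per :: "real \<Rightarrow> (real \<Rightarrow> real) set" where
  "H1_per T = {v. \<exists>w. has_weak_deriv T v w}"

text \<open>The weak derivative is unique up to a null set, so the choice below does not affect
  any of the integrals in which it occurs.\<close>

definition weak_deriv :: "real \<Rightarrow> (real \<Rightarrow> real) \<Rightarrow> real \<Rightarrow> real" where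
  "weak_deriv T v = (SOME w. has_weak_deriv T v w)"

definition H1_per_zero :: "real \<Rightarrow> (real \<Rightarrow> real) set" where
  "H1_per_zero T = {v \<in> H1_per T. (LBINT x:{0..T}. v x) = 0}"

definition H1_norm :: "real \<Rightarrow> (real \<Rightarrow> real) \<Rightarrow> real" where
  "H1_norm T v = sqrt (LBINT x:{0..T}. (v x)\<^sup>2 + (weak_deriv T v x)\<^sup>2)"

definition primitive :: "(real \<Rightarrow> real) \<Rightarrow> real \<Rightarrow> real" where
  "primitive v x = (LBINT y=0..x. v y)"

definition zero_mean_antideriv :: "real \<Rightarrow> (real \<Rightarrow> real) \<Rightarrow> real \<Rightarrow> real" where
  "zero_mean_antideriv T v x = primitive v x - (LBINT y:{0..T}. primitive v y) / T"


subsection \<open>The periodic wave\<close>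

definition periodic_wave :: "real \<Rightarrow> real \<Rightarrow> (real \<Rightarrow> real) \<Rightarrow> bool" where
  "periodic_wave \<gamma> I U \<longleftrightarrow>
     smooth U \<and> periodic (2 * pi) U \<and> (\<forall>z. U (- z) = U z) \<and> (LBINT z:{0..2 * pi}. U z) = 0 \<and>
     (\<forall>z. ((\<lambda>z. (\<gamma> - (U z)\<^sup>2 / 2) * deriv U z) has_real_derivative - U z) (at z)) \<and>
     (\<forall>z. I = (\<gamma> - (U z)\<^sup>2 / 2)\<^sup>2 * (deriv U z)\<^sup>2 / 2 + \<gamma> / 2 * (U z)\<^sup>2 - (U z) ^ 4 / 8) \<and>
     (\<forall>z. \<bar>U z\<bar> < sqrt (2 * \<gamma>)) \<and> (\<forall>z. \<bar>deriv U z\<bar> < 1) \<and> \<gamma>\<^sup>2 - 2 * I > 0"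

text \<open>The branch of small-amplitude waves, indexed by the amplitude \<open>a \<in> (0, a0)\<close>. The amplitude
  is taken positive: \<open>-a\<close> gives the same wave shifted by half a period. The range condition and
  monotonicity express that the waves with \<open>\<gamma> > 1\<close> close to \<open>1\<close> correspond one-to-one to small
  amplitudes. The error term of \<open>U\<close> is uniform in \<open>z\<close>.\<close>

definition small_amplitude_waves ::
  "real \<Rightarrow> (real \<Rightarrow> real) \<Rightarrow> (real \<Rightarrow> real) \<Rightarrow> (real \<Rightarrow> real \<Rightarrow> real) \<Rightarrow> bool" where
  "small_amplitude_waves a0 \<gamma> I U \<longleftrightarrow>
     a0 > 0 \<and>
     strict_mono_on {0<..<a0} \<gamma> \<and> (\<exists>\<gamma>1>1. \<gamma> ` {0<..<a0} = {1<..<\<gamma>1}) \<and>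
     (\<forall>a\<in>{0<..<a0}. periodic_wave (\<gamma> a) (I a) (U a)) \<and>
     (\<exists>K. \<forall>\<^sub>F a in at_right 0. \<forall>z.
        \<bar>U a z - (a * cos z + 3 / 64 * a ^ 3 * cos (3 * z))\<bar> \<le> K * a ^ 5) \<and>
     (\<lambda>a. \<gamma> a - (1 + a\<^sup>2 / 8)) \<in> O[at_right 0](\<lambda>a. a ^ 4) \<and>
     (\<lambda>a. I a - a\<^sup>2 / 2) \<in> O[at_right 0](\<lambda>a. a ^ 4)"


subsection \<open>The quadratic form\<close>

definition delta2_Lambda ::
  "real \<Rightarrow> real \<Rightarrow> real \<Rightarrow> real \<Rightarrow> (real \<Rightarrow> real) \<Rightarrow> (real \<Rightarrow> real) \<Rightarrow> real" where
  "delta2_Lambda T c \<gamma> I U v =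
     (LBINT z:{0..T}.
        (zero_mean_antideriv T v z)\<^sup>2
        - (\<gamma> - (U z)\<^sup>2 / 2) * (v z)\<^sup>2
        - c * (v z)\<^sup>2 / (2 * (\<gamma>\<^sup>2 - 2 * I) powr (1 / 2))
        + c * (weak_deriv T v z)\<^sup>2 / (2 * (1 - (deriv U z)\<^sup>2) powr (3 / 2)))"

end

theory Submission
  imports Defs
begin

text \<open>
  Put \<open>\<psi> = \<gamma> - U\<^sup>2/2\<close>, \<open>m = sqrt (\<gamma>\<^sup>2 - 2 I)\<close>, \<open>P = \<psi>\<^sup>3/m\<^sup>2\<close>. Conservation of \<open>I\<close> reads \<open>\<psi>\<^sup>2 (1 - U'\<^sup>2) = m\<^sup>2\<close>, so
  with \<open>\<kappa> = c/(2 m)\<close> and \<open>w\<close> the antiderivative of \<open>v\<close> the quadratic form is the integral of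
  \<open>w\<^sup>2 - (\<psi> + \<kappa>) w'\<^sup>2 + \<kappa> P w''\<^sup>2\<close>, and \<open>w = U\<close> is in its kernel because \<open>P U'' = - U\<close>. Adding the exact
  derivative \<open>(A w'\<^sup>2 + 2 B w w' + C w\<^sup>2)'\<close> with suitable coefficients built from \<open>U\<close> turns the density
  into the sum of squares \<open>\<kappa> P (w'' + (A w' + B w)/(\<kappa> P))\<^sup>2 + \<rho> (U w' - U' w)\<^sup>2\<close>. The coefficients
  contain one free function; it can be chosen so that, for \<open>\<kappa> = m + t e\<close> with
  \<open>e\<^sup>2 = 2 (\<gamma> - m)\<close> and \<open>e\<close> close to \<open>a\<close>, the weight is \<open>\<rho> = (1 - t\<^sup>2)/2 + O(e)\<close>. It is therefore positive at
  \<open>t = \<plusminus>(1 - 24 e)\<close>, uniformly in the number \<open>N\<close> of periods, and these two values of \<open>c\<close> are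
  \<open>2 \<plusminus> 2 a + O(a\<^sup>2)\<close>. Both squares vanish only for multiples of \<open>U\<close>, which the constraint excludes;
  variation of constants makes this quantitative. The form is affine in \<open>c\<close>, so coercivity at the two
  endpoints gives coercivity in between.
\<close>

section \<open>Absolutely continuous functions and weak derivatives\<close>

text \<open>Absolute continuity on \<open>{0..T}\<close>, encoded by the integral equation itself.
  The derivative \<open>f\<close> matters only up to null sets, as for weak derivatives.\<close>

definition ac_deriv :: "real \<Rightarrow> (real \<Rightarrow> real) \<Rightarrow> (real \<Rightarrow> real) \<Rightarrow> bool" where
  "ac_deriv T F f \<longleftrightarrow> set_integrable lborel {0..T} f \<and>
     (\<forall>x\<in>{0..T}. (LBINT y:{0..x}. f y) = F x - F 0)"

lemma ac_deriv_integrable: "ac_deriv T F f \<Longrightarrow> set_integrable lborel {0..T} f"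
  by (simp add: ac_deriv_def)

lemma ac_deriv_eq: "ac_deriv T F f \<Longrightarrow> 0 \<le> x \<Longrightarrow> x \<le> T \<Longrightarrow> F x = F 0 + (LBINT y:{0..x}. f y)"
  by (simp add: ac_deriv_def)

lemma continuous_on_set_integral_upto:
  assumes "set_integrable lborel {0..T::real} (f::real\<Rightarrow>real)"
  shows "continuous_on {0..T} (\<lambda>x. LBINT y:{0..x}. f y)"
proof -
  have "f integrable_on {0..T}" 
    using set_borel_integral_eq_integral(1)[OF assms] .
  then have "continuous_on {0..T} (\<lambda>x. integral {0..x} f)"
    by (rule indefinite_integral_continuous_1)
  moreover have "integral {0..x} f = (LBINT y:{0..x}. f y)" if "x \<in> {0..T}" for x
    using set_borel_integral_eq_integral(2)[OF set_integrable_subset[OF assms, of "{0..x}"]] that by auto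
  ultimately show ?thesis by (rule continuous_on_eq)
qed

lemma ac_deriv_continuous:
  assumes "ac_deriv T F f" shows "continuous_on {0..T} F"
proof -
  have "continuous_on {0..T} (\<lambda>x. F 0 + (LBINT y:{0..x}. f y))"
    using continuous_on_set_integral_upto[OF ac_deriv_integrable[OF assms]] by (intro continuous_intros)
  then show ?thesis
    by (rule continuous_on_eq) (metis ac_deriv_eq[OF assms] atLeastAtMost_iff)
qed

lemma continuous_on_Icc_bound:
  fixes f :: "real \<Rightarrow> real"
  assumes "continuous_on {a..b} f"
  obtains K where "\<And>x. x \<in> {a..b} \<Longrightarrow> \<bar>f x\<bar> \<le> K"
proof -
  have "bounded (f ` {a..b})"
    by (rule compact_imp_bounded[OF compact_continuous_image[OF assms compact_Icc]])
  then obtain K where "\<forall>y\<in>f ` {a..b}. \<bar>y\<bar> \<le> K" unfolding bounded_iff real_norm_def by blast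
  then show ?thesis using that by blast
qed

lemma set_integrable_continuous_mult:
  fixes F f :: "real \<Rightarrow> real"
  assumes "continuous_on {a..b} F" "set_integrable lborel {a..b} f"
  shows "set_integrable lborel {a..b} (\<lambda>x. F x * f x)"
proof -
  obtain K where K: "\<And>x. x \<in> {a..b} \<Longrightarrow> \<bar>F x\<bar> \<le> K"
    using continuous_on_Icc_bound[OF assms(1)] by blast
  have mF: "set_borel_measurable lborel {a..b} F"
    using borel_measurable_continuous_on_indicator[OF _ assms(1)] by (simp add: set_borel_measurable_def)
  have mf: "set_borel_measurable lborel {a..b} f"
    using assms(2) by (auto simp: set_borel_measurable_def set_integrable_def)
  have "set_integrable lborel {a..b} (\<lambda>x. K * f x)" using assms(2) by simp
  then show ?thesis
  proof (rule set_integrable_bound)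
    have "(\<lambda>x. (indicator {a..b} x *\<^sub>R F x) * (indicator {a..b} x *\<^sub>R f x)) \<in> borel_measurable lborel"
      using mF mf unfolding set_borel_measurable_def by measurable
    also have "(\<lambda>x. (indicator {a..b} x *\<^sub>R F x) * (indicator {a..b} x *\<^sub>R f x)) = (\<lambda>x. indicator {a..b} x *\<^sub>R (F x * f x))"
      by (auto simp: indicator_def)
    finally show "set_borel_measurable lborel {a..b} (\<lambda>x. F x * f x)" by (simp add: set_borel_measurable_def)
    show "AE x in lborel. x \<in> {a..b} \<longrightarrow> norm (F x * f x) \<le> norm (K * f x)"
      by (rule AE_I2) (auto simp: abs_mult intro!: mult_right_mono order_trans[OF K])
  qed
qed

lemma set_integrable_continuous_Icc:
  fixes F :: "real \<Rightarrow> real"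
  shows "continuous_on {a..b} F \<Longrightarrow> set_integrable lborel {a..b} F"
  unfolding set_integrable_def by (rule borel_integrable_compact) simp_all

text \<open>Integration by parts for two indefinite integrals: Fubini for the kernel
  \<open>f s * g t\<close> on a square that the diagonal splits into two triangles.\<close>

lemma set_integral_upto_mult:
  fixes f g :: "real \<Rightarrow> real"
  assumes "set_integrable lborel {0..x} f" "set_integrable lborel {0..x} g"
  shows "(LBINT s:{0..x}. f s * (LBINT t:{0..s}. g t)) + (LBINT t:{0..x}. (LBINT s:{0..t}. f s) * g t)
    = (LBINT s:{0..x}. f s) * (LBINT t:{0..x}. g t)"
proof -
  define F where "F = (\<lambda>s. indicator {0..x} s * f s)"
  define G where "G = (\<lambda>s. indicator {0..x} s * g s)"
  have iF: "integrable lborel F" and iG: "integrable lborel G"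
    using assms by (auto simp: F_def G_def set_integrable_def)
  have mF[measurable]: "F \<in> borel_measurable borel" "G \<in> borel_measurable borel"
    using iF iG by auto
  have iK: "integrable (lborel \<Otimes>\<^sub>M lborel) (\<lambda>(s,t). F s * G t)"
  proof (rule lborel_pair.Fubini_integrable)
    show "(\<lambda>(s,t). F s * G t) \<in> borel_measurable (lborel \<Otimes>\<^sub>M lborel)" by measurable
    show "AE s in lborel. integrable lborel (\<lambda>t. case (s, t) of (s, t) \<Rightarrow> F s * G t)"
      using iG by simp
    show "integrable lborel (\<lambda>s. LINT t|lborel. norm (case (s, t) of (s, t) \<Rightarrow> F s * G t))"
      using iF by (simp add: abs_mult)
  qed
  \<comment> \<open>\<open>K1\<close> takes the closed triangle and \<open>K2\<close> the open one,
    so that the two kernels add up to the product everywhere, diagonal included.\<close>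
  define K1 where "K1 = (\<lambda>(s::real,t::real). (if t \<le> s then 1 else 0) * (F s * G t))"
  define K2 where "K2 = (\<lambda>(s::real,t::real). (if s < t then 1 else 0) * (F s * G t))"
  have i1: "integrable (lborel \<Otimes>\<^sub>M lborel) K1"
    by (rule Bochner_Integration.integrable_bound[OF iK]) (auto simp: K1_def)
  have i2: "integrable (lborel \<Otimes>\<^sub>M lborel) K2"
    by (rule Bochner_Integration.integrable_bound[OF iK]) (auto simp: K2_def)
  have K12: "K1 z + K2 z = (\<lambda>(s,t). F s * G t) z" for z by (auto simp: K1_def K2_def split: prod.splits)
  have a: "integral\<^sup>L (lborel \<Otimes>\<^sub>M lborel) K1 + integral\<^sup>L (lborel \<Otimes>\<^sub>M lborel) K2
     = integral\<^sup>L (lborel \<Otimes>\<^sub>M lborel) (\<lambda>(s,t). F s * G t)"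
    by (subst Bochner_Integration.integral_add[OF i1 i2, symmetric]) (simp add: K12)
  have "integral\<^sup>L (lborel \<Otimes>\<^sub>M lborel) (\<lambda>(s,t). F s * G t) = (LINT s|lborel. LINT t|lborel. F s * G t)"
    using lborel_pair.integral_fst'[OF iK] by simp
  also have "\<dots> = integral\<^sup>L lborel F * integral\<^sup>L lborel G" by simp
  finally have b: "integral\<^sup>L (lborel \<Otimes>\<^sub>M lborel) (\<lambda>(s,t). F s * G t) = (LBINT s:{0..x}. f s) * (LBINT t:{0..x}. g t)"
    by (simp add: F_def G_def set_lebesgue_integral_def)
  have "integral\<^sup>L (lborel \<Otimes>\<^sub>M lborel) K1 = (LINT s|lborel. LINT t|lborel. K1 (s,t))"
    using lborel_pair.integral_fst'[OF i1] by simp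
  also have "\<dots> = (LBINT s:{0..x}. f s * (LBINT t:{0..s}. g t))"
    unfolding set_lebesgue_integral_def
  proof (rule Bochner_Integration.integral_cong[OF refl])
    fix s
    have "(LINT t|lborel. K1 (s,t)) = (LINT t|lborel. F s * (indicator {0..s} t * g t))"
      by (rule Bochner_Integration.integral_cong[OF refl]) (auto simp: K1_def F_def G_def indicator_def)
    then show "(LINT t|lborel. K1 (s,t)) = indicator {0..x} s *\<^sub>R (f s * (LINT t|lborel. indicator {0..s} t *\<^sub>R g t))"
      by (simp add: F_def)
  qed
  finally have c: "integral\<^sup>L (lborel \<Otimes>\<^sub>M lborel) K1 = (LBINT s:{0..x}. f s * (LBINT t:{0..s}. g t))" .
  have "integral\<^sup>L (lborel \<Otimes>\<^sub>M lborel) K2 = (LINT t|lborel. LINT s|lborel. K2 (s,t))"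
    using lborel_pair.integral_snd[of "\<lambda>s t. K2 (s,t)"] i2 by simp
  also have "\<dots> = (LBINT t:{0..x}. (LBINT s:{0..t}. f s) * g t)"
    unfolding set_lebesgue_integral_def
  proof (rule Bochner_Integration.integral_cong[OF refl])
    fix t
    have "(LINT s|lborel. K2 (s,t)) = (LINT s|lborel. (indicator {0..t} s * f s) * G t)"
    proof (rule integral_cong_AE)
      \<comment> \<open>\<open>K2\<close> omits the diagonal, while the inner integral runs over the
        closed \<open>{0..t}\<close>; the two integrands can differ only at the single point
        \<open>s = t\<close>.\<close>
      have "AE s in lborel. s \<noteq> t" by (rule AE_lborel_singleton)
      then show "AE s in lborel. K2 (s,t) = (indicator {0..t} s * f s) * G t"
        by eventually_elim (auto simp: K2_def F_def G_def indicator_def)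
      show "(\<lambda>s. K2 (s,t)) \<in> borel_measurable lborel" unfolding K2_def by simp
      have "(\<lambda>s. indicator {0..t} s * F s * G t) \<in> borel_measurable lborel" by simp
      also have "(\<lambda>s. indicator {0..t} s * F s * G t) = (\<lambda>s. indicator {0..t} s * f s * G t)"
        by (auto simp: F_def G_def indicator_def)
      finally show "(\<lambda>s. indicator {0..t} s * f s * G t) \<in> borel_measurable lborel" .
    qed
    then show "(LINT s|lborel. K2 (s,t)) = indicator {0..x} t *\<^sub>R ((LINT s|lborel. indicator {0..t} s *\<^sub>R f s) * g t)"
      by (simp add: G_def)
  qed
  finally have d: "integral\<^sup>L (lborel \<Otimes>\<^sub>M lborel) K2 = (LBINT t:{0..x}. (LBINT s:{0..t}. f s) * g t)" .
  show ?thesis using a b c d by simp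
qed

lemma ac_deriv_subinterval:
  "ac_deriv T F f \<Longrightarrow> x \<le> T \<Longrightarrow> ac_deriv x F f"
  unfolding ac_deriv_def using set_integrable_subset[of lborel "{0..T}" f "{0..x}"] by auto

text \<open>The Leibniz rule. Writing \<open>F\<close> and \<open>G\<close> as initial value plus
  indefinite integral reduces it to \<open>set_integral_upto_mult\<close>.\<close>

lemma ac_deriv_mult:
  assumes F: "ac_deriv T F f" and G: "ac_deriv T G g"
  shows "ac_deriv T (\<lambda>x. F x * G x) (\<lambda>x. f x * G x + F x * g x)"
  unfolding ac_deriv_def
proof (intro conjI ballI)
  have *: "set_integrable lborel {0..T} (\<lambda>x. f x * G x)" "set_integrable lborel {0..T} (\<lambda>x. F x * g x)"
    if "ac_deriv T F f" "ac_deriv T G g" for T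
    using set_integrable_continuous_mult[OF ac_deriv_continuous ac_deriv_integrable] that
    by (auto simp: mult.commute)
  show "set_integrable lborel {0..T} (\<lambda>x. f x * G x + F x * g x)"
    using *[OF F G] by simp
  fix x assume x: "x \<in> {0..T}"
  then have Fx: "ac_deriv x F f" and Gx: "ac_deriv x G g"
    using ac_deriv_subinterval[OF F] ac_deriv_subinterval[OF G] by simp_all
  note if_ = ac_deriv_integrable[OF Fx] and ig_ = ac_deriv_integrable[OF Gx]
  let ?If = "LBINT y:{0..x}. f y" and ?Ig = "LBINT y:{0..x}. g y"
  have i1: "set_integrable lborel {0..x} (\<lambda>s. f s * (LBINT t:{0..s}. g t))"
    using set_integrable_continuous_mult[OF continuous_on_set_integral_upto if_, OF ig_] by (simp add: mult.commute)
  have i2: "set_integrable lborel {0..x} (\<lambda>s. (LBINT t:{0..s}. f t) * g s)"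
    using set_integrable_continuous_mult[OF continuous_on_set_integral_upto ig_, OF if_] by simp
  have "(LBINT y:{0..x}. f y * G y + F y * g y) =
     (LBINT y:{0..x}. (G 0 * f y + f y * (LBINT t:{0..y}. g t)) + (F 0 * g y + (LBINT t:{0..y}. f t) * g y))"
  proof (rule set_lebesgue_integral_cong, goal_cases)
    case 2
    show ?case
    proof (intro allI impI)
      fix y assume y: "y \<in> {0..x}"
      show "f y * G y + F y * g y = (G 0 * f y + f y * (LBINT t:{0..y}. g t)) + (F 0 * g y + (LBINT t:{0..y}. f t) * g y)"
        using ac_deriv_eq[OF Fx, of y] ac_deriv_eq[OF Gx, of y] y by (simp add: algebra_simps)
    qed
  qed simp
  also have "\<dots> = (G 0 * ?If + (LBINT y:{0..x}. f y * (LBINT t:{0..y}. g t))) + (F 0 * ?Ig + (LBINT y:{0..x}. (LBINT t:{0..y}. f t) * g y))"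
    using i1 i2 if_ ig_ by simp
  also have "\<dots> = G 0 * ?If + F 0 * ?Ig + ?If * ?Ig"
    using set_integral_upto_mult[OF if_ ig_] by simp
  finally show "(LBINT y:{0..x}. f y * G y + F y * g y) = F x * G x - F 0 * G 0"
    using ac_deriv_eq[OF Fx, of x] ac_deriv_eq[OF Gx, of x] x by (simp add: algebra_simps)
qed

lemma ac_deriv_add:
  assumes F: "ac_deriv T F f" and G: "ac_deriv T G g"
  shows "ac_deriv T (\<lambda>x. F x + G x) (\<lambda>x. f x + g x)"
  unfolding ac_deriv_def
proof (intro conjI ballI)
  show "set_integrable lborel {0..T} (\<lambda>x. f x + g x)" using F G by (simp add: ac_deriv_def)
  fix x assume x: "x \<in> {0..T}"
  then have "ac_deriv x F f" "ac_deriv x G g" using ac_deriv_subinterval[OF F] ac_deriv_subinterval[OF G] by simp_all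
  then show "(LBINT y:{0..x}. f y + g y) = F x + G x - (F 0 + G 0)"
    using x ac_deriv_eq[of x F f x] ac_deriv_eq[of x G g x]
    by (simp add: ac_deriv_integrable)
qed

lemma ac_deriv_C1:
  assumes "\<And>x. 0 \<le> x \<Longrightarrow> x \<le> T \<Longrightarrow> (F has_real_derivative f x) (at x)" "continuous_on {0..T} f"
  shows "ac_deriv T F f"
  unfolding ac_deriv_def
proof (intro conjI ballI)
  show "set_integrable lborel {0..T} f" using set_integrable_continuous_Icc assms(2) .
  fix x assume x: "x \<in> {0..T}"
  have "set_integrable lborel {0..x} f"
    by (rule set_integrable_continuous_Icc[OF continuous_on_subset[OF assms(2)]]) (use x in auto)
  moreover have "(f has_integral (F x - F 0)) {0..x}"
    by (rule fundamental_theorem_of_calculus)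
      (use x assms(1) in \<open>auto simp: has_real_derivative_iff_has_vector_derivative[symmetric] intro: has_field_derivative_at_within\<close>)
  ultimately show "(LBINT y:{0..x}. f y) = F x - F 0"
    using set_borel_integral_eq_integral(2)[of "{0..x}" f] by (simp add: integral_unique)
qed

lemma set_integral_const_Icc: "0 \<le> T \<Longrightarrow> (LBINT x:{0..T}. k) = T * (k::real)"
  by (simp add: set_lebesgue_integral_def)

lemma set_integrable_const_Icc: "set_integrable lborel {a..b::real} (\<lambda>x. k::real)"
  by (rule set_integrable_continuous_Icc) simp

lemma ac_deriv_cmult:
  assumes "ac_deriv T F f" shows "ac_deriv T (\<lambda>x. k * F x) (\<lambda>x. k * f x)"
  using assms unfolding ac_deriv_def by (simp add: right_diff_distrib)

lemma set_integral_cong_AE_integrable: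
  fixes f g :: "real \<Rightarrow> real"
  assumes "set_integrable lborel A f" "set_integrable lborel A g" "AE x in lborel. x \<in> A \<longrightarrow> f x = g x"
  shows "(LBINT x:A. f x) = (LBINT x:A. g x)"
  unfolding set_lebesgue_integral_def
proof (rule integral_cong_AE)
  show "AE x in lborel. indicat_real A x *\<^sub>R f x = indicat_real A x *\<^sub>R g x"
    using assms(3) by eventually_elim (auto simp: indicator_def)
qed (use assms(1,2) in \<open>auto simp: set_integrable_def\<close>)

section \<open>Smooth test functions and trigonometric polynomials\<close>

lemma smooth_DERIV:
  assumes "smooth f" shows "(f has_real_derivative deriv f x) (at x)"
proof -
  have "f differentiable (at x)" using assms[unfolded smooth_def, rule_format, of 0 x] by simp
  then show ?thesis by (simp add: DERIV_deriv_iff_real_differentiable)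
qed

lemma smooth_deriv: "smooth f \<Longrightarrow> smooth (deriv f)"
proof -
  assume f: "smooth f"
  have "(deriv ^^ k) (deriv f) = (deriv ^^ Suc k) f" for k
    by (simp add: funpow_swap1)
  with f show "smooth (deriv f)" unfolding smooth_def by metis
qed

lemma smoothI:
  assumes "\<And>x. (f has_real_derivative g x) (at x)" "smooth g"
  shows "smooth f"
  unfolding smooth_def
proof (intro allI)
  fix k x
  have *: "deriv f = g" using assms(1) DERIV_imp_deriv by blast
  show "(deriv ^^ k) f differentiable (at x)"
  proof (cases k)
    case 0 then show ?thesis using assms(1) real_differentiable_def by auto
  next
    case (Suc l)
    then have "(deriv ^^ k) f = (deriv ^^ l) g" by (simp add: funpow_Suc_right * del: funpow.simps)
    then show ?thesis using assms(2) unfolding smooth_def by simp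
  qed
qed

lemma smooth_continuous: "smooth f \<Longrightarrow> continuous_on A f"
  by (intro continuous_at_imp_continuous_on ballI DERIV_isCont[OF smooth_DERIV])

text \<open>Closure under products makes this an algebra: every polynomial in \<open>cos\<close> and
  \<open>sin\<close> of \<open>\<omega> * x\<close> belongs to it, with no reduction to Fourier
  sums, and derivatives are handled by induction.\<close>

inductive trig_poly :: "real \<Rightarrow> (real \<Rightarrow> real) \<Rightarrow> bool" for \<omega> where
  const: "trig_poly \<omega> (\<lambda>x. c)"
| cos: "trig_poly \<omega> (\<lambda>x. cos (\<omega> * x))"
| sin: "trig_poly \<omega> (\<lambda>x. sin (\<omega> * x))"
| add: "trig_poly \<omega> p \<Longrightarrow> trig_poly \<omega> q \<Longrightarrow> trig_poly \<omega> (\<lambda>x. p x + q x)"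
| mult: "trig_poly \<omega> p \<Longrightarrow> trig_poly \<omega> q \<Longrightarrow> trig_poly \<omega> (\<lambda>x. p x * q x)"

lemma trig_poly_deriv:
  assumes "trig_poly \<omega> p"
  shows "\<exists>q. trig_poly \<omega> q \<and> (\<forall>x. (p has_real_derivative q x) (at x))"
  using assms
proof induction
  case (const c)
  show ?case by (rule exI[of _ "\<lambda>x. 0"]) (auto intro: trig_poly.intros)
next
  case cos
  have "trig_poly \<omega> (\<lambda>x. (- \<omega>) * sin (\<omega> * x))"
    by (rule trig_poly.mult[OF trig_poly.const trig_poly.sin])
  moreover have "((\<lambda>x. cos (\<omega> * x)) has_real_derivative (- \<omega>) * sin (\<omega> * x)) (at x)" for x
    by (auto intro!: derivative_eq_intros)
  ultimately show ?case by blast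
next
  case sin
  have "trig_poly \<omega> (\<lambda>x. \<omega> * cos (\<omega> * x))"
    by (rule trig_poly.mult[OF trig_poly.const trig_poly.cos])
  moreover have "((\<lambda>x. sin (\<omega> * x)) has_real_derivative \<omega> * cos (\<omega> * x)) (at x)" for x
    by (auto intro!: derivative_eq_intros)
  ultimately show ?case by blast
next
  case (add p q)
  then obtain p' q' where pq: "trig_poly \<omega> p'" "\<And>x. (p has_real_derivative p' x) (at x)"
     "trig_poly \<omega> q'" "\<And>x. (q has_real_derivative q' x) (at x)" by blast
  have "((\<lambda>x. p x + q x) has_real_derivative p' x + q' x) (at x)" for x
    by (rule DERIV_add[OF pq(2,4)])
  then show ?case using trig_poly.add[OF pq(1,3)] by blast
next
  case (mult p q)
  then obtain p' q' where pq: "trig_poly \<omega> p'" "\<And>x. (p has_real_derivative p' x) (at x)"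
     "trig_poly \<omega> q'" "\<And>x. (q has_real_derivative q' x) (at x)" by blast
  have "trig_poly \<omega> (\<lambda>x. p' x * q x + q' x * p x)"
    by (intro trig_poly.add trig_poly.mult pq mult)
  moreover have "((\<lambda>x. p x * q x) has_real_derivative p' x * q x + q' x * p x) (at x)" for x
    by (rule DERIV_mult[OF pq(2,4)])
  ultimately show ?case by blast
qed

lemma trig_poly_smooth: 
  assumes "trig_poly \<omega> p" shows "smooth p"
proof -
  have "trig_poly \<omega> ((deriv ^^ k) p)" for k
  proof (induction k)
    case (Suc k)
    then obtain q where q: "trig_poly \<omega> q" "\<forall>x. ((deriv ^^ k) p has_real_derivative q x) (at x)"
      using trig_poly_deriv by blast
    then have "deriv ((deriv ^^ k) p) = q" using DERIV_imp_deriv by blast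
    then show ?case using q by simp
  qed (use assms in simp)
  then show ?thesis unfolding smooth_def
    using trig_poly_deriv real_differentiable_def by blast
qed

lemma trig_poly_periodic:
  assumes "trig_poly \<omega> p" "\<omega> * T = 2 * pi" shows "periodic T p"
  using assms
  by (induction) (auto simp: periodic_def distrib_left)

text \<open>Equal endpoint values make \<open>H\<close> a continuous function on the circle.
  Stone-Weierstrass gives a polynomial in real and imaginary part there, which becomes a
  trigonometric polynomial along \<open>cis\<close>.\<close>

lemma trig_poly_approx:
  assumes H: "continuous_on {0..T} H" "H 0 = H T" and T: "T > 0" and e: "e > 0"
  obtains p where "trig_poly (2 * pi / T) p" "\<And>x. x \<in> {0..T} \<Longrightarrow> \<bar>H x - p x\<bar> < e"
proof -
  define g where "g = (\<lambda>t. H (T * t))"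
  have pg: "path g" unfolding path_def g_def
    by (rule continuous_on_compose2[OF H(1)]) (use T in \<open>auto intro!: continuous_intros simp: mult_left_le\<close>)
  \<comment> \<open>The trivial homotopy only serves to obtain continuity of the induced map on the
    circle, also at the point \<open>1\<close> where \<open>Arg2pi\<close> jumps.\<close>
  have "homotopic_loops UNIV g g"
    unfolding homotopic_loops_refl using pg H(2) by (simp add: pathfinish_def pathstart_def g_def)
  from homotopic_loops_imp_homotopic_circlemaps[OF this]
  have c: "continuous_on (sphere 0 1) (g \<circ> (\<lambda>z. Arg2pi z / (2 * pi)))"
    using homotopic_with_imp_continuous by blast
  obtain q where q: "real_polynomial_function q"
    "\<And>z. z \<in> sphere 0 1 \<Longrightarrow> \<bar>(g \<circ> (\<lambda>z. Arg2pi z / (2 * pi))) z - q z\<bar> < e"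
  proof (rule Stone_Weierstrass_real_polynomial_function[OF compact_sphere c e], goal_cases)
    case (1 q) from this(1)[OF this(2,3)] show ?case .
  qed
  define p where "p = (\<lambda>x. q (cis (2 * pi / T * x)))"
  have "trig_poly (2 * pi / T) (\<lambda>x. q (cis (2 * pi / T * x)))" using q(1)
  proof induction
    case (linear f)
    interpret bounded_linear f by fact
    have "f z = Re z * f 1 + Im z * f \<i>" for z
    proof -
      have "z = Re z *\<^sub>R 1 + Im z *\<^sub>R \<i>" by (simp add: complex_eq_iff)
      then have "f z = f (Re z *\<^sub>R 1 + Im z *\<^sub>R \<i>)" by (rule arg_cong)
      then show ?thesis by (simp only: add scaleR real_scaleR_def)
    qed
    then obtain a b where ab: "\<And>z. f z = Re z * a + Im z * b" by blast
    show ?case unfolding ab cis.sel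
      by (intro trig_poly.add trig_poly.mult trig_poly.cos trig_poly.sin trig_poly.const)
  qed (auto intro: trig_poly.intros)
  then have tp: "trig_poly (2 * pi / T) p" by (simp add: p_def)
  moreover have "\<bar>H x - p x\<bar> < e" if x: "x \<in> {0..T}" for x
  proof -
    have less: "\<bar>H x - p x\<bar> < e" if x: "0 \<le> x" "x < T" for x
    proof -
      have "Arg2pi (cis (2 * pi / T * x)) = 2 * pi / T * x"
        by (rule Arg2pi_unique[of 1]) (use x T in \<open>auto simp: cis_conv_exp field_simps\<close>)
      then have "(g \<circ> (\<lambda>z. Arg2pi z / (2 * pi))) (cis (2 * pi / T * x)) = H x"
        using T by (simp add: g_def)
      then show ?thesis using q(2)[of "cis (2 * pi / T * x)"] by (simp add: p_def)
    qed
    \<comment> \<open>\<open>Arg2pi\<close> stays below \<open>2 * pi\<close>, so the endpoint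
      \<open>T\<close> is reduced to \<open>0\<close> by periodicity.\<close>
    show ?thesis
    proof (cases "x = T")
      case True
      have "periodic T p" by (rule trig_poly_periodic[OF tp]) (use T in simp)
      then have "p (0 + T) = p 0" unfolding periodic_def by blast
      then show ?thesis using less[of 0] H(2) T True by simp
    qed (use less[of x] x in auto)
  qed
  ultimately show ?thesis using that by blast
qed

section \<open>The du Bois-Reymond lemma for periodic functions\<close>

text \<open>A Dynkin argument: the Borel sets over which the zero extension of \<open>h\<close>
  integrates to 0 are closed under complements and countable disjoint unions, and contain the
  half-lines, an intersection-stable generator.\<close>

lemma set_integral_upto_zero_imp_AE_zero:
  fixes h :: "real \<Rightarrow> real"
  assumes h: "set_integrable lborel {0..T} h" and z: "\<And>x. x \<in> {0..T} \<Longrightarrow> (LBINT y:{0..x}. h y) = 0"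
  shows "AE x in lborel. x \<in> {0..T} \<longrightarrow> h x = 0"
proof -
  define f where "f = (\<lambda>x. indicator {0..T} x *\<^sub>R h x)"
  have f: "integrable lborel f" using h by (simp add: f_def set_integrable_def)
  have base: "(LBINT y:{..x}. f y) = 0" for x
  proof -
    have "(LBINT y:{..x}. f y) = (LBINT y:{0..min x T}. h y)"
      unfolding set_lebesgue_integral_def
      by (rule Bochner_Integration.integral_cong) (auto simp: f_def indicator_def)
    also have "\<dots> = 0"
    proof (cases "0 \<le> min x T")
      case True then show ?thesis using z[of "min x T"] by simp
    next
      case False then show ?thesis by (simp add: set_lebesgue_integral_def)
    qed
    finally show ?thesis .
  qed
  have si: "set_integrable lborel A f" if "A \<in> sets borel" for A
    using integrable_mult_indicator[OF _ f, of A] that by (simp add: set_integrable_def)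
  have un: "(LBINT y:(\<Union>i. F i). f y) = 0"
    if "disjoint_family F" "range F \<subseteq> sets borel" "\<And>i. (LBINT y:F i. f y) = 0" for F :: "nat \<Rightarrow> real set"
  proof -
    have m: "F i \<in> sets borel" for i using that by auto
    then have "(\<Union>i. F i) \<in> sets borel" by auto
    then have "(LBINT y:(\<Union>i. F i). f y) = (\<Sum>i. (LBINT y:F i. f y))"
      using that m by (intro lebesgue_integral_countable_add si) (auto simp: disjoint_family_on_def)
    then show ?thesis using that by simp
  qed
  have tot: "(LBINT y:UNIV. f y) = 0"
  proof -
    have "(LBINT y:UNIV. f y) = (LBINT y:{..T}. f y)"
      unfolding set_lebesgue_integral_def
      by (rule Bochner_Integration.integral_cong) (auto simp: f_def indicator_def)
    then show ?thesis using base by simp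
  qed
  have st: "Int_stable (range (\<lambda>a::real. {..a}))"
    by (auto simp: Int_stable_def)
  have sub: "range (\<lambda>a::real. {..a}) \<subseteq> Pow UNIV" by simp
  have eq: "sets borel = sigma_sets UNIV (range (\<lambda>a::real. {..a}))"
    unfolding borel_eq_atMost by simp
  have all: "(LBINT y:A. f y) = 0" if "A \<in> sets borel" for A
  proof -
    from that have "A \<in> sigma_sets UNIV (range (\<lambda>a::real. {..a}))" using eq by simp
    from st sub this show ?thesis
    proof (induction rule: sigma_sets_induct_disjoint)
      case (basic A) then show ?case using base by auto
    next
      case empty show ?case by (simp add: set_lebesgue_integral_def)
    next
      case (compl A)
      then have A: "A \<in> sets borel" using eq by simp
      have "(LBINT y:A \<union> (UNIV - A). f y) = (LBINT y:A. f y) + (LBINT y:(UNIV - A). f y)"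
        by (rule set_integral_Un) (use A si in auto)
      moreover have "A \<union> (UNIV - A) = UNIV" by auto
      ultimately show ?case using tot compl by simp
    next
      case (union F) then show ?case by (intro un) (auto simp: eq)
    qed
  qed
  have "AE x in lborel. f x = 0"
    by (rule sigma_finite_measure.density_zero[OF lborel.sigma_finite_measure_axioms f]) (use all in simp)
  then show ?thesis by eventually_elim (auto simp: f_def)
qed

text \<open>The increment of an antiderivative over one period does not depend on the starting
  point, and it equals the integral of \<open>\<phi>\<close> over a period, which is 0.\<close>

lemma smooth_periodic_antideriv:
  assumes \<phi>: "smooth \<phi>" "periodic T \<phi>" and z: "(LBINT x:{0..T}. \<phi> x) = 0" and T: "T > 0"
  obtains \<Phi> where "smooth \<Phi>" "periodic T \<Phi>" "deriv \<Phi> = \<phi>"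
proof -
  have "\<exists>F. \<forall>x::real. -\<infinity> < ereal x \<longrightarrow> ereal x < \<infinity> \<longrightarrow> (F has_vector_derivative \<phi> x) (at x)"
    by (rule einterval_antiderivative) (use smooth_DERIV[OF \<phi>(1)] DERIV_isCont in auto)
  then obtain F where F: "\<And>x. (F has_real_derivative \<phi> x) (at x)"
    by (auto simp: has_real_derivative_iff_has_vector_derivative)
  have ac: "ac_deriv T F \<phi>" by (rule ac_deriv_C1[OF F smooth_continuous[OF \<phi>(1)]])
  then have FT: "F T = F 0" using z T by (simp add: ac_deriv_def)
  have "((\<lambda>x. F (x + T) - F x) has_real_derivative 0) (at x)" for x
  proof -
    have "((\<lambda>x. F (x + T) - F x) has_real_derivative \<phi> (x + T) * 1 - \<phi> x) (at x)"
      by (intro derivative_intros DERIV_chain2[OF F]) (auto intro!: derivative_eq_intros F)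
    then show ?thesis using \<phi>(2) by (simp add: periodic_def)
  qed
  then have "F (x + T) - F x = F (0 + T) - F 0" for x
    by (rule DERIV_isconst_all[rule_format])
  then have "periodic T F" using FT by (simp add: periodic_def)
  moreover have "deriv F = \<phi>" using F DERIV_imp_deriv by blast
  moreover have "smooth F" using smoothI[OF F \<phi>(1)] .
  ultimately show ?thesis using that by blast
qed

text \<open>A test function minus its mean is the derivative of a test function; the subtracted mean
  is then moved from \<open>\<phi>\<close> onto \<open>h\<close>.\<close>

lemma orthogonal_derivs_imp_orthogonal:
  assumes h: "set_integrable lborel {0..T} h" and T: "T > 0"
    and z: "\<And>\<phi>. smooth \<phi> \<Longrightarrow> periodic T \<phi> \<Longrightarrow> (LBINT x:{0..T}. h x * deriv \<phi> x) = 0"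
    and \<phi>: "smooth \<phi>" "periodic T \<phi>"
  shows "(LBINT x:{0..T}. (h x - (LBINT y:{0..T}. h y) / T) * \<phi> x) = 0"
proof -
  define \<mu> where "\<mu> = (LBINT y:{0..T}. \<phi> y) / T"
  define \<nu> where "\<nu> = (LBINT y:{0..T}. h y) / T"
  have i\<phi>: "set_integrable lborel {0..T} \<phi>"
    by (rule set_integrable_continuous_Icc[OF smooth_continuous[OF \<phi>(1)]])
  have ih: "set_integrable lborel {0..T} (\<lambda>x. h x * \<phi> x)"
    using set_integrable_continuous_mult[OF smooth_continuous[OF \<phi>(1)] h] by (simp add: mult.commute)
  note c = set_integral_const_Icc[of T] and ic = set_integrable_const_Icc
  have "smooth (\<lambda>x. \<phi> x - \<mu>)"
  proof (rule smoothI[OF _ smooth_deriv[OF \<phi>(1)]])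
    show "((\<lambda>x. \<phi> x - \<mu>) has_real_derivative deriv \<phi> x) (at x)" for x
      using DERIV_diff[OF smooth_DERIV[OF \<phi>(1), of x] DERIV_const[of \<mu>]] by simp
  qed
  moreover have "periodic T (\<lambda>x. \<phi> x - \<mu>)" using \<phi>(2) by (simp add: periodic_def)
  moreover have "(LBINT x:{0..T}. \<phi> x - \<mu>) = 0"
    using T by (simp add: set_integral_diff i\<phi> ic c \<mu>_def)
  ultimately obtain \<Phi> where \<Phi>: "smooth \<Phi>" "periodic T \<Phi>" "deriv \<Phi> = (\<lambda>x. \<phi> x - \<mu>)"
    using smooth_periodic_antideriv T by metis
  have "0 = (LBINT x:{0..T}. h x * (\<phi> x - \<mu>))" using z[OF \<Phi>(1,2)] \<Phi>(3) by simp
  also have "\<dots> = (LBINT x:{0..T}. h x * \<phi> x) - \<mu> * (LBINT x:{0..T}. h x)"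
    using ih h by (simp add: right_diff_distrib)
  finally have 1: "(LBINT x:{0..T}. h x * \<phi> x) = \<mu> * (LBINT x:{0..T}. h x)" by simp
  have "(LBINT x:{0..T}. (h x - \<nu>) * \<phi> x) = (LBINT x:{0..T}. h x * \<phi> x) - \<nu> * (LBINT x:{0..T}. \<phi> x)"
    using ih i\<phi> by (simp add: left_diff_distrib)
  then show ?thesis using 1 T by (simp add: \<mu>_def \<nu>_def)
qed

text \<open>If a trigonometric polynomial \<open>p\<close> is uniformly within \<open>e\<close> of
  \<open>k\<close>, orthogonality turns the integral of the square of \<open>k\<close> into that of
  \<open>k * (k - p)\<close>, which is at most \<open>e\<close> times the integral of the modulus of
  \<open>k\<close>.\<close>

lemma continuous_orthogonal_smooth_imp_zero:
  assumes k: "continuous_on {0..T} k" "k 0 = k T" and T: "T > 0"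
    and z: "\<And>\<phi>. smooth \<phi> \<Longrightarrow> periodic T \<phi> \<Longrightarrow> (LBINT x:{0..T}. k x * \<phi> x) = 0"
    and x: "x \<in> {0..T}"
  shows "k x = 0"
proof -
  note I = set_integrable_continuous_Icc
  have ia: "set_integrable lborel {0..T} (\<lambda>x. \<bar>k x\<bar>)"
    and ik: "set_integrable lborel {0..T} (\<lambda>x. (k x)\<^sup>2)"
    by (intro I continuous_intros k)+
  define A where "A = (LBINT x:{0..T}. \<bar>k x\<bar>)"
  have A0: "0 \<le> A" unfolding A_def set_lebesgue_integral_def by (rule integral_nonneg_AE) auto
  have "(LBINT x:{0..T}. (k x)\<^sup>2) \<le> e * A" if e: "e > 0" for e
  proof -
    obtain p where p: "trig_poly (2 * pi / T) p" "\<And>x. x \<in> {0..T} \<Longrightarrow> \<bar>k x - p x\<bar> < e"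
      using trig_poly_approx[OF k T e] by blast
    have cp: "continuous_on {0..T} p" using smooth_continuous[OF trig_poly_smooth[OF p(1)]] .
    have "(LBINT x:{0..T}. k x * p x) = 0"
      by (rule z[OF trig_poly_smooth[OF p(1)] trig_poly_periodic[OF p(1)]]) (use T in simp)
    then have "(LBINT x:{0..T}. (k x)\<^sup>2) = (LBINT x:{0..T}. (k x)\<^sup>2) - (LBINT x:{0..T}. k x * p x)" by simp
    also have "\<dots> = (LBINT x:{0..T}. (k x)\<^sup>2 - k x * p x)"
      by (rule set_integral_diff(2)[symmetric]) (intro I continuous_intros k cp)+
    also have "\<dots> \<le> (LBINT x:{0..T}. e * \<bar>k x\<bar>)"
    proof (rule set_integral_mono)
      show "set_integrable lborel {0..T} (\<lambda>x. (k x)\<^sup>2 - k x * p x)" by (intro I continuous_intros k cp)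
      show "set_integrable lborel {0..T} (\<lambda>x. e * \<bar>k x\<bar>)" using ia by simp
      fix x assume "x \<in> {0..T}"
      have "(k x)\<^sup>2 - k x * p x = k x * (k x - p x)" by (simp add: power2_eq_square algebra_simps)
      also have "\<dots> \<le> \<bar>k x\<bar> * \<bar>k x - p x\<bar>" by (metis abs_ge_self abs_mult)
      also have "\<dots> \<le> \<bar>k x\<bar> * e" using p(2)[OF \<open>x \<in> _\<close>] by (intro mult_left_mono) auto
      finally show "(k x)\<^sup>2 - k x * p x \<le> e * \<bar>k x\<bar>" by (simp add: mult.commute)
    qed
    finally show ?thesis by (simp add: A_def)
  qed
  then have le: "(LBINT x:{0..T}. (k x)\<^sup>2) \<le> 0 + d" if "d > 0" for d
  proof -
    \<comment> \<open>The tolerance \<open>d / (A + 1)\<close> makes the bound at most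
      \<open>d\<close>; the added 1 covers \<open>A = 0\<close>.\<close>
    have "d / (A + 1) > 0" using that A0 by simp
    then have "(LBINT x:{0..T}. (k x)\<^sup>2) \<le> d / (A + 1) * A"
      using \<open>\<And>e. e > 0 \<Longrightarrow> _\<close> by blast
    also have "\<dots> \<le> d" using A0 that by (simp add: field_simps)
    finally show ?thesis by simp
  qed
  then have "(LBINT x:{0..T}. (k x)\<^sup>2) \<le> 0" by (rule field_le_epsilon)
  moreover have "0 \<le> (LBINT x:{0..T}. (k x)\<^sup>2)"
    unfolding set_lebesgue_integral_def by (rule integral_nonneg_AE) auto
  ultimately have "integral {0..T} (\<lambda>x. (k x)\<^sup>2) = 0"
    using set_borel_integral_eq_integral(2)[OF ik] by simp
  then have "\<forall>x\<in>{0..T}. (k x)\<^sup>2 = 0"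
    by (subst (asm) integral_eq_0_iff) (use T in \<open>auto intro!: continuous_intros k\<close>)
  then show ?thesis using x by simp
qed

text \<open>As \<open>h\<close> is merely integrable, uniform approximation is applied to the
  primitive \<open>H\<close> of \<open>h\<close> minus its mean, which is continuous with equal
  endpoint values. Integration by parts makes \<open>H\<close> orthogonal to all derivatives of test
  functions, hence constant, hence 0.\<close>

lemma orthogonal_derivs_imp_AE_const:
  assumes h: "set_integrable lborel {0..T} h" and T: "T > 0"
    and z: "\<And>\<phi>. smooth \<phi> \<Longrightarrow> periodic T \<phi> \<Longrightarrow> (LBINT x:{0..T}. h x * deriv \<phi> x) = 0"
  shows "\<exists>k. AE x in lborel. x \<in> {0..T} \<longrightarrow> h x = k"
proof -
  define \<nu> where "\<nu> = (LBINT y:{0..T}. h y) / T"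
  define h0 where "h0 = (\<lambda>x. h x - \<nu>)"
  define H where "H = (\<lambda>x. LBINT y:{0..x}. h0 y)"
  note c = set_integral_const_Icc[of T] and ic = set_integrable_const_Icc
  have h0: "set_integrable lborel {0..T} h0" unfolding h0_def using h ic by simp
  have H0: "H 0 = 0" unfolding H_def set_lebesgue_integral_def
    by (rule integral_eq_zero_AE) (use AE_lborel_singleton[of 0] in eventually_elim, auto simp: indicator_def)
  have HT: "H T = 0" unfolding H_def h0_def using h ic c T by (simp add: \<nu>_def)
  have aH: "ac_deriv T H h0" unfolding ac_deriv_def using h0 H0 by (simp add: H_def)
  have cH: "continuous_on {0..T} H" using ac_deriv_continuous[OF aH] .
  have o: "(LBINT x:{0..T}. h0 x * \<phi> x) = 0" if "smooth \<phi>" "periodic T \<phi>" for \<phi>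
    using orthogonal_derivs_imp_orthogonal[OF h T z that] by (simp add: h0_def \<nu>_def)
  have oH: "(LBINT x:{0..T}. H x * deriv \<phi> x) = 0" if p: "smooth \<phi>" "periodic T \<phi>" for \<phi>
  proof -
    have a\<phi>: "ac_deriv T \<phi> (deriv \<phi>)"
      by (rule ac_deriv_C1[OF smooth_DERIV[OF p(1)] smooth_continuous[OF smooth_deriv[OF p(1)]]])
    have "(LBINT x:{0..T}. h0 x * \<phi> x + H x * deriv \<phi> x) = H T * \<phi> T - H 0 * \<phi> 0"
      using ac_deriv_mult[OF aH a\<phi>] T by (simp add: ac_deriv_def)
    moreover have "set_integrable lborel {0..T} (\<lambda>x. h0 x * \<phi> x)" "set_integrable lborel {0..T} (\<lambda>x. H x * deriv \<phi> x)"
      using set_integrable_continuous_mult[OF smooth_continuous[OF p(1)] h0]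
        set_integrable_continuous_mult[OF cH ac_deriv_integrable[OF a\<phi>]] by (simp_all add: mult.commute)
    ultimately show ?thesis using o[OF p] H0 HT by simp
  qed
  define \<kappa> where "\<kappa> = (LBINT y:{0..T}. H y) / T"
  have k: "H x - \<kappa> = 0" if "x \<in> {0..T}" for x
  proof (rule continuous_orthogonal_smooth_imp_zero[where T=T and x=x and k="\<lambda>x. H x - \<kappa>"])
    show "(LBINT x:{0..T}. (H x - \<kappa>) * \<phi> x) = 0" if "smooth \<phi>" "periodic T \<phi>" for \<phi>
      using orthogonal_derivs_imp_orthogonal[OF set_integrable_continuous_Icc[OF cH] T oH that] by (simp add: \<kappa>_def)
  qed (use that T cH H0 HT in \<open>auto intro!: continuous_intros\<close>)
  have "H x = 0" if "x \<in> {0..T}" for x using k[OF that] k[of 0] H0 T by simp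
  then have "AE x in lborel. x \<in> {0..T} \<longrightarrow> h0 x = 0"
    by (intro set_integral_upto_zero_imp_AE_zero[OF h0]) (simp add: H_def)
  then have "AE x in lborel. x \<in> {0..T} \<longrightarrow> h x = \<nu>" by eventually_elim (simp add: h0_def)
  then show ?thesis by blast
qed

section \<open>Absolutely continuous representatives of weakly differentiable functions\<close>

lemma L2_per_integrable:
  assumes "v \<in> L2_per T" shows "set_integrable lborel {0..T} v"
proof -
  have v: "v \<in> borel_measurable borel" "set_integrable lborel {0..T} (\<lambda>x. (v x)\<^sup>2)"
    using assms by (auto simp: L2_per_def)
  have "set_integrable lborel {0..T} (\<lambda>x. 1 + (v x)\<^sup>2)"
    using v(2) set_integrable_continuous_Icc[of 0 T "\<lambda>x. 1"] by simp
  then show ?thesis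
  proof (rule set_integrable_bound)
    show "set_borel_measurable lborel {0..T} v" using v(1) by (simp add: set_borel_measurable_def)
    have "\<bar>y\<bar> \<le> 1 + y\<^sup>2" for y :: real
      using zero_le_power2[of "\<bar>y\<bar> - 1"] by (auto simp: power2_eq_square algebra_simps abs_if split: if_splits)
    then show "AE x in lborel. x \<in> {0..T} \<longrightarrow> norm (v x) \<le> norm (1 + (v x)\<^sup>2)"
      by (intro AE_I2) (simp add: abs_of_nonneg)
  qed
qed

text \<open>The difference of \<open>v\<close> and the indefinite integral of \<open>d\<close> is
  orthogonal to all derivatives of test functions, so it is constant almost everywhere.\<close>

lemma weak_deriv_ac_representative:
  assumes w: "has_weak_deriv T v d" and T: "T > 0"
  obtains V where "ac_deriv T V d" "V 0 = V T" "AE x in lborel. x \<in> {0..T} \<longrightarrow> v x = V x"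
proof -
  have iv: "set_integrable lborel {0..T} v" and id: "set_integrable lborel {0..T} d"
    using w L2_per_integrable by (auto simp: has_weak_deriv_def)
  have test: "(LBINT x:{0..T}. v x * deriv \<phi> x) = - (LBINT x:{0..T}. d x * \<phi> x)"
    if "smooth \<phi>" "periodic T \<phi>" for \<phi>
    using w that by (auto simp: has_weak_deriv_def L2_inner_def)
  \<comment> \<open>Testing with the constant 1 shows that \<open>d\<close> has mean zero; its
    primitive \<open>D\<close> then vanishes at both endpoints and produces no boundary terms
    below.\<close>
  have "(LBINT x:{0..T}. v x * deriv (\<lambda>x. 1) x) = - (LBINT x:{0..T}. d x * 1)"
    by (rule test) (auto intro: trig_poly_smooth trig_poly.const simp: periodic_def)
  then have d0: "(LBINT x:{0..T}. d x) = 0" by simp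
  define D where "D = (\<lambda>x. LBINT y:{0..x}. d y)"
  have D0: "D 0 = 0" unfolding D_def set_lebesgue_integral_def
    by (rule integral_eq_zero_AE) (use AE_lborel_singleton[of 0] in eventually_elim, auto simp: indicator_def)
  have DT: "D T = 0" using d0 by (simp add: D_def)
  have aD: "ac_deriv T D d" unfolding ac_deriv_def using id D0 by (simp add: D_def)
  have iD: "set_integrable lborel {0..T} D" by (rule set_integrable_continuous_Icc[OF ac_deriv_continuous[OF aD]])
  have "\<exists>k. AE x in lborel. x \<in> {0..T} \<longrightarrow> v x - D x = k"
  proof (rule orthogonal_derivs_imp_AE_const[OF _ T])
    show "set_integrable lborel {0..T} (\<lambda>x. v x - D x)" using iv iD by simp
    fix \<phi> assume p: "smooth \<phi>" "periodic T \<phi>"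
    have a\<phi>: "ac_deriv T \<phi> (deriv \<phi>)"
      by (rule ac_deriv_C1[OF smooth_DERIV[OF p(1)] smooth_continuous[OF smooth_deriv[OF p(1)]]])
    have i1: "set_integrable lborel {0..T} (\<lambda>x. d x * \<phi> x)" "set_integrable lborel {0..T} (\<lambda>x. v x * deriv \<phi> x)"
      using set_integrable_continuous_mult[OF smooth_continuous[OF p(1)] id]
        set_integrable_continuous_mult[OF smooth_continuous[OF smooth_deriv[OF p(1)]] iv]
      by (simp_all add: mult.commute)
    have i2: "set_integrable lborel {0..T} (\<lambda>x. D x * deriv \<phi> x)"
      using set_integrable_continuous_mult[OF ac_deriv_continuous[OF aD] ac_deriv_integrable[OF a\<phi>]] .
    have "(LBINT x:{0..T}. d x * \<phi> x + D x * deriv \<phi> x) = D T * \<phi> T - D 0 * \<phi> 0"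
      using ac_deriv_mult[OF aD a\<phi>] T by (simp add: ac_deriv_def)
    then have "(LBINT x:{0..T}. d x * \<phi> x) + (LBINT x:{0..T}. D x * deriv \<phi> x) = 0"
      using i1 i2 D0 DT by simp
    then show "(LBINT x:{0..T}. (v x - D x) * deriv \<phi> x) = 0"
      using i1 i2 test[OF p] by (simp add: left_diff_distrib)
  qed
  then obtain k where k: "AE x in lborel. x \<in> {0..T} \<longrightarrow> v x - D x = k" by blast
  show ?thesis
  proof (rule that[of "\<lambda>x. D x + k"])
    show "ac_deriv T (\<lambda>x. D x + k) d" using aD by (simp add: ac_deriv_def)
    show "D 0 + k = D T + k" using D0 DT by simp
    show "AE x in lborel. x \<in> {0..T} \<longrightarrow> v x = D x + k" using k by eventually_elim auto
  qed
qed

text \<open>Provides functions to which the product rule applies: the absolutely continuous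
  representative \<open>V\<close> of \<open>v\<close>, and an antiderivative with equal endpoint
  values because \<open>v\<close> has mean zero.\<close>

lemma H1_per_zeroE:
  assumes v: "v \<in> H1_per_zero T" and T: "T > 0"
  obtains V where "has_weak_deriv T v (weak_deriv T v)" "ac_deriv T V (weak_deriv T v)" "V 0 = V T"
    "AE x in lborel. x \<in> {0..T} \<longrightarrow> v x = V x" "ac_deriv T (zero_mean_antideriv T v) V"
    "zero_mean_antideriv T v 0 = zero_mean_antideriv T v T"
proof -
  let ?w = "zero_mean_antideriv T v"
  have wd: "has_weak_deriv T v (weak_deriv T v)"
    unfolding weak_deriv_def by (rule someI_ex[of "has_weak_deriv T v"]) (use v in \<open>auto simp: H1_per_zero_def H1_per_def\<close>)
  obtain V where V: "ac_deriv T V (weak_deriv T v)" "V 0 = V T" "AE x in lborel. x \<in> {0..T} \<longrightarrow> v x = V x"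
    by (rule weak_deriv_ac_representative[OF wd T])
  have iv: "set_integrable lborel {0..T} v" using wd L2_per_integrable by (auto simp: has_weak_deriv_def)
  have iV: "set_integrable lborel {0..T} V" by (rule set_integrable_continuous_Icc[OF ac_deriv_continuous[OF V(1)]])
  have eq: "?w x - ?w 0 = (LBINT y:{0..x}. v y)" if "0 \<le> x" for x
  proof -
    have "primitive v x = (LBINT y:{0..x}. v y)"
      unfolding primitive_def zero_ereal_def by (rule interval_integral_Icc[OF that])
    moreover have "primitive v 0 = 0" unfolding primitive_def zero_ereal_def by simp
    ultimately show ?thesis by (simp add: zero_mean_antideriv_def)
  qed
  have "ac_deriv T ?w V" unfolding ac_deriv_def
  proof (intro conjI ballI iV)
    fix x assume x: "x \<in> {0..T}"
    have "(LBINT y:{0..x}. V y) = (LBINT y:{0..x}. v y)"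
    proof (rule set_integral_cong_AE_integrable)
      show "AE y in lborel. y \<in> {0..x} \<longrightarrow> V y = v y" using V(3) by eventually_elim (use x in auto)
    qed (use set_integrable_subset[OF iV, of "{0..x}"] set_integrable_subset[OF iv, of "{0..x}"] x in auto)
    then show "(LBINT y:{0..x}. V y) = ?w x - ?w 0" using eq x by simp
  qed
  moreover have "?w 0 = ?w T" using eq[of T] T v by (simp add: H1_per_zero_def)
  ultimately show ?thesis by (rule that[OF wd V])
qed

section \<open>Coercivity of the sum of squares\<close>

lemma set_integrable_square_affine:
  fixes c k d :: "real \<Rightarrow> real"
  assumes "continuous_on {a..b} c" "continuous_on {a..b} k"
    "set_integrable lborel {a..b} d" "set_integrable lborel {a..b} (\<lambda>x. (d x)\<^sup>2)"
  shows "set_integrable lborel {a..b} (\<lambda>x. (c x * d x + k x)\<^sup>2)"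
proof -
  have "set_integrable lborel {a..b} (\<lambda>x. (c x)\<^sup>2 * (d x)\<^sup>2 + (2 * c x * k x) * d x + (k x)\<^sup>2)"
    by (intro set_integral_add set_integrable_continuous_mult[OF _ assms(4)] set_integrable_continuous_mult[OF _ assms(3)]
        set_integrable_continuous_Icc continuous_intros assms)
  also have "(\<lambda>x. (c x)\<^sup>2 * (d x)\<^sup>2 + (2 * c x * k x) * d x + (k x)\<^sup>2) = (\<lambda>x. (c x * d x + k x)\<^sup>2)"
    by (simp add: fun_eq_iff power2_eq_square algebra_simps)
  finally show ?thesis .
qed

text \<open>Cauchy-Schwarz against the constant 1, obtained by expanding the nonnegative integral of
  the squared deviation of \<open>f\<close> from its mean.\<close>

lemma set_integral_square_le:
  fixes f :: "real \<Rightarrow> real"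
  assumes "set_integrable lborel {0..T} f" "set_integrable lborel {0..T} (\<lambda>x. (f x)\<^sup>2)" "T > 0"
  shows "(LBINT x:{0..T}. f x)\<^sup>2 \<le> T * (LBINT x:{0..T}. (f x)\<^sup>2)"
proof -
  define a where "a = (LBINT x:{0..T}. f x) / T"
  have "0 \<le> (LBINT x:{0..T}. (f x - a)\<^sup>2)"
    unfolding set_lebesgue_integral_def by (rule integral_nonneg_AE) auto
  also have "(LBINT x:{0..T}. (f x - a)\<^sup>2) = (LBINT x:{0..T}. ((f x)\<^sup>2 - (2 * a) * f x) + a\<^sup>2)"
    by (rule set_lebesgue_integral_cong) (auto simp: power2_eq_square algebra_simps)
  also have "\<dots> = ((LBINT x:{0..T}. (f x)\<^sup>2) - (2 * a) * (LBINT x:{0..T}. f x)) + T * a\<^sup>2"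
    using assms set_integrable_const_Icc set_integral_const_Icc[of T] by simp
  finally have "0 \<le> T * ((LBINT x:{0..T}. (f x)\<^sup>2) - (2 * a) * (LBINT x:{0..T}. f x) + T * a\<^sup>2)"
    using assms(3) by simp
  also have "\<dots> = T * (LBINT x:{0..T}. (f x)\<^sup>2) - (LBINT x:{0..T}. f x)\<^sup>2"
    using assms(3) by (simp add: a_def field_simps power2_eq_square)
  finally show ?thesis by simp
qed

lemma continuous_on_Icc_common_bound:
  fixes fs :: "(real \<Rightarrow> real) list"
  assumes "\<And>f. f \<in> set fs \<Longrightarrow> continuous_on {a..b} f"
  obtains K where "K \<ge> 1" "\<And>f x. f \<in> set fs \<Longrightarrow> x \<in> {a..b} \<Longrightarrow> \<bar>f x\<bar> \<le> K"
proof -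
  have "\<exists>K\<ge>1. \<forall>f\<in>set fs. \<forall>x\<in>{a..b}. \<bar>f x\<bar> \<le> K" using assms
  proof (induction fs)
    case Nil then show ?case by (intro exI[of _ 1]) simp
  next
    case (Cons f fs)
    then obtain K where K: "K \<ge> 1" "\<forall>f\<in>set fs. \<forall>x\<in>{a..b}. \<bar>f x\<bar> \<le> K" by auto
    obtain L where L: "\<And>x. x \<in> {a..b} \<Longrightarrow> \<bar>f x\<bar> \<le> L"
      using continuous_on_Icc_bound[of a b f] Cons.prems by auto
    have "max K L \<ge> 1" using K by simp
    moreover have "\<forall>g\<in>set (f # fs). \<forall>x\<in>{a..b}. \<bar>g x\<bar> \<le> max K L"
      using K(2) L by (auto simp: le_max_iff_disj)
    ultimately show ?case by blast
  qed
  then show ?thesis using that by blast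
qed

lemma set_integral_affine_Icc:
  assumes "set_integrable lborel {0..T} f" "0 \<le> T"
  shows "(LBINT x:{0..T}. k + l * f x) = T * k + l * (LBINT x:{0..T}. f x :: real)"
  using assms set_integrable_const_Icc set_integral_const_Icc[of T] by simp

lemma square_add_le: "(x + y)\<^sup>2 \<le> 2 * x\<^sup>2 + 2 * (y::real)\<^sup>2"
  using sum_squares_bound[of x y] by (simp add: power2_sum)

lemma square_mult_le:
  fixes c x :: real
  assumes "\<bar>c\<bar> \<le> b" shows "(c * x)\<^sup>2 \<le> b\<^sup>2 * x\<^sup>2"
proof -
  have "c\<^sup>2 \<le> b\<^sup>2" using assms by (metis abs_ge_zero power2_abs power_mono)
  then show ?thesis by (simp add: power_mult_distrib mult_right_mono)
qed

text \<open>Variation of constants: \<open>w\<close> is written as \<open>E U - h U1\<close> and \<open>v\<close> as \<open>E U1 + h U\<close>, where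
  \<open>h\<close> is the Wronskian divided by \<open>U\<^sup>2 + U1\<^sup>2\<close>. The derivative of \<open>E\<close> involves only the two quantities on
  the right-hand side, and the orthogonality condition fixes the constant of integration of \<open>E\<close>.\<close>

lemma coercive_from_wronskian:
  fixes U U1 \<alpha> \<beta> :: "real \<Rightarrow> real"
  assumes T: "T > 0"
    and dU: "\<And>x. (U has_real_derivative U1 x) (at x)"
    and dU1: "\<And>x. (U1 has_real_derivative - \<alpha> x * U1 x - \<beta> x * U x) (at x)"
    and c\<alpha>: "continuous_on {0..T} \<alpha>" and c\<beta>: "continuous_on {0..T} \<beta>"
    and nt: "\<And>x. (U x)\<^sup>2 + (U1 x)\<^sup>2 > 0"
    and S: "(LBINT x:{0..T}. (U1 x)\<^sup>2) > 0"
  obtains M where "M > 0"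
    "\<And>w v d. ac_deriv T w v \<Longrightarrow> ac_deriv T v d \<Longrightarrow> set_integrable lborel {0..T} (\<lambda>x. (d x)\<^sup>2) \<Longrightarrow>
      (LBINT x:{0..T}. U1 x * v x) = 0 \<Longrightarrow>
      (LBINT x:{0..T}. (v x)\<^sup>2 + (d x)\<^sup>2)
        \<le> M * (LBINT x:{0..T}. (d x + \<alpha> x * v x + \<beta> x * w x)\<^sup>2 + (U x * v x - U1 x * w x)\<^sup>2)"
proof -
  define n where "n = (\<lambda>x. (U x)\<^sup>2 + (U1 x)\<^sup>2)"
  define U2 where "U2 = (\<lambda>x. - \<alpha> x * U1 x - \<beta> x * U x)"
  define n1 where "n1 = (\<lambda>x. 2 * U x * U1 x + 2 * U1 x * U2 x)"
  \<comment> \<open>\<open>c1\<close> and \<open>c2\<close> are the coefficients in the derivative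
    of \<open>E\<close>, which turns out to be \<open>c1 * g1 + c2 * g2\<close>; \<open>U2\<close>
    is the second derivative of \<open>U\<close>.\<close>
  define c1 where "c1 = (\<lambda>x. U1 x / n x)"
  define c2 where "c2 = (\<lambda>x. ((U x)\<^sup>2 - (U1 x)\<^sup>2 + U x * U2 x - \<alpha> x * U x * U1 x + \<beta> x * (U1 x)\<^sup>2) / (n x)\<^sup>2)"
  have n0: "n x > 0" for x using nt by (simp add: n_def)
  have n0': "n x \<noteq> 0" for x using n0[of x] by simp
  have cU: "continuous_on {0..T} U" using dU by (intro continuous_at_imp_continuous_on ballI DERIV_isCont)
  have cU1: "continuous_on {0..T} U1" using dU1 by (intro continuous_at_imp_continuous_on ballI DERIV_isCont)
  note cc = cU cU1 c\<alpha> c\<beta>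
  have cU2: "continuous_on {0..T} U2" unfolding U2_def by (intro continuous_intros cc)
  have cn: "continuous_on {0..T} n" unfolding n_def by (intro continuous_intros cc)
  have cn1: "continuous_on {0..T} n1" unfolding n1_def by (intro continuous_intros cc cU2)
  have cc1: "continuous_on {0..T} c1" unfolding c1_def by (intro continuous_intros cc cn) (use n0' in auto)
  have cc2: "continuous_on {0..T} c2" unfolding c2_def by (intro continuous_intros cc cn cU2) (use n0' in auto)
  have ci: "continuous_on {0..T} (\<lambda>x. 1 / n x)" by (intro continuous_intros cn) (use n0' in auto)
  obtain b where b0: "b \<ge> 1"
    and bd: "\<And>f x. f \<in> set [U, U1, \<alpha>, \<beta>, \<lambda>x. 1 / n x, c1, c2] \<Longrightarrow> x \<in> {0..T} \<Longrightarrow> \<bar>f x\<bar> \<le> b"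
    by (rule continuous_on_Icc_common_bound[of "[U, U1, \<alpha>, \<beta>, \<lambda>x. 1 / n x, c1, c2]" 0 T])
      (use cc ci cc1 cc2 in auto)
  have bb: "\<bar>U x\<bar> \<le> b" "\<bar>U1 x\<bar> \<le> b" "\<bar>\<alpha> x\<bar> \<le> b" "\<bar>\<beta> x\<bar> \<le> b" "\<bar>1 / n x\<bar> \<le> b" "\<bar>c1 x\<bar> \<le> b" "\<bar>c2 x\<bar> \<le> b"
    if x: "x \<in> {0..T}" for x
    using bd[OF _ x, of U] bd[OF _ x, of U1] bd[OF _ x, of \<alpha>] bd[OF _ x, of \<beta>] bd[OF _ x, of "\<lambda>x. 1 / n x"]
      bd[OF _ x, of c1] bd[OF _ x, of c2] by simp_all
  define s where "s = (LBINT x:{0..T}. (U1 x)\<^sup>2)"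
  \<comment> \<open>With \<open>J\<close> the integral of \<open>g1\<close> squared plus
    \<open>g2\<close> squared, \<open>K1 * J\<close> bounds the squared oscillation of
    \<open>E\<close>, \<open>Z * J\<close> the integral of the squared remainder \<open>r\<close> in
    the orthogonality condition, and \<open>K3 * J\<close> the square of \<open>E\<close>.
    \<open>M\<close> collects these.\<close>
  define K1 where "K1 = 2 * T * b\<^sup>2"
  define Z where "Z = T * (2 * b ^ 4 * K1) + 2 * b ^ 6"
  define K3 where "K3 = 2 * (K1 + T * Z / s\<^sup>2)"
  define M where "M = 3 + (1 + 6 * b\<^sup>2) * (2 * b\<^sup>2 * K3 * T + 2 * b ^ 4)"
  have K1: "K1 \<ge> 0" and Z0: "Z \<ge> 0" using T b0 by (auto simp: K1_def Z_def)
  have K3: "K3 \<ge> 0" using K1 Z0 T by (simp add: K3_def)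
  have M: "M > 0" unfolding M_def using K3 T b0 by (intro add_pos_nonneg mult_nonneg_nonneg) auto
  show ?thesis
  proof (rule that[OF M])
    fix w v d
    assume aw: "ac_deriv T w v" and av: "ac_deriv T v d" and id2: "set_integrable lborel {0..T} (\<lambda>x. (d x)\<^sup>2)"
      and orth: "(LBINT x:{0..T}. U1 x * v x) = 0"
    have id: "set_integrable lborel {0..T} d" by (rule ac_deriv_integrable[OF av])
    have cw: "continuous_on {0..T} w" and cv: "continuous_on {0..T} v"
      using ac_deriv_continuous[OF aw] ac_deriv_continuous[OF av] by auto
    define g1 where "g1 = (\<lambda>x. d x + \<alpha> x * v x + \<beta> x * w x)"
    define g2 where "g2 = (\<lambda>x. U x * v x - U1 x * w x)"
    define E where "E = (\<lambda>x. (U x * w x + U1 x * v x) * (1 / n x))"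
    define h where "h = (\<lambda>x. g2 x / n x)"
    \<comment> \<open>The vector \<open>(w, v)\<close> is expanded in the orthogonal frame
      \<open>(U, U1)\<close>, \<open>(- U1, U)\<close>, both of squared length
      \<open>n\<close>.\<close>
    have w_eq: "w x = E x * U x - h x * U1 x" and v_eq: "v x = E x * U1 x + h x * U x" for x
    proof -
      have "w x * n x = (U x * w x + U1 x * v x) * U x - g2 x * U1 x" 
        by (simp add: n_def g2_def power2_eq_square algebra_simps)
      then have "w x = ((U x * w x + U1 x * v x) * U x - g2 x * U1 x) / n x"
        using n0'[of x] by (simp add: eq_divide_eq)
      then show "w x = E x * U x - h x * U1 x" unfolding E_def h_def diff_divide_distrib by simp
      have "v x * n x = (U x * w x + U1 x * v x) * U1 x + g2 x * U x" 
        by (simp add: n_def g2_def power2_eq_square algebra_simps)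
      then have "v x = ((U x * w x + U1 x * v x) * U1 x + g2 x * U x) / n x"
        using n0'[of x] by (simp add: eq_divide_eq)
      then show "v x = E x * U1 x + h x * U x" unfolding E_def h_def add_divide_distrib by simp
    qed
    have aU: "ac_deriv T U U1" by (rule ac_deriv_C1[OF dU cU1])
    have aU1: "ac_deriv T U1 U2" by (rule ac_deriv_C1[OF dU1[folded U2_def[THEN fun_cong]] cU2])
    have ain: "ac_deriv T (\<lambda>x. 1 / n x) (\<lambda>x. - n1 x / (n x)\<^sup>2)"
    proof (rule ac_deriv_C1)
      fix x
      have "(n has_real_derivative n1 x) (at x)" unfolding n_def n1_def U2_def
        by (auto intro!: derivative_eq_intros dU dU1)
      then show "((\<lambda>x. 1 / n x) has_real_derivative - n1 x / (n x)\<^sup>2) (at x)"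
        using n0'[of x] by (auto intro!: derivative_eq_intros simp: power2_eq_square)
    qed (use n0' in \<open>auto intro!: continuous_intros cn cn1\<close>)
    define E1 where "E1 = (\<lambda>x. ((U1 x * w x + U x * v x) + (U2 x * v x + U1 x * d x)) * (1 / n x)
        + (U x * w x + U1 x * v x) * (- n1 x / (n x)\<^sup>2))"
    have aE: "ac_deriv T E E1" unfolding E_def E1_def
      by (rule ac_deriv_mult[OF ac_deriv_add[OF ac_deriv_mult[OF aU aw] ac_deriv_mult[OF aU1 av]] ain])
    \<comment> \<open>All terms containing \<open>E\<close> cancel: \<open>(U, U1, U2)\<close> makes
      both \<open>g1\<close> and \<open>g2\<close> vanish, so a multiple of it contributes
      nothing.\<close>
    have E1: "E1 x = c1 x * g1 x + c2 x * g2 x" for x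
    proof -
      have d: "d x = g1 x - \<alpha> x * v x - \<beta> x * w x" by (simp add: g1_def)
      have Uw: "U x * w x + U1 x * v x = E x * n x" using n0'[of x] by (simp add: E_def)
      have "E1 x = ((U1 x * w x + U x * v x) + (U2 x * v x + U1 x * d x) - E x * n1 x) / n x"
        unfolding E1_def Uw using n0'[of x] by (simp add: field_simps power2_eq_square)
      also have "(U1 x * w x + U x * v x) + (U2 x * v x + U1 x * d x) - E x * n1 x
         = U1 x * g1 x + h x * ((U x)\<^sup>2 - (U1 x)\<^sup>2 + U x * U2 x - \<alpha> x * U x * U1 x + \<beta> x * (U1 x)\<^sup>2)"
        unfolding d unfolding w_eq v_eq n1_def U2_def by (simp add: algebra_simps power2_eq_square)
      finally show ?thesis by (simp add: c1_def c2_def h_def add_divide_distrib[of "U1 x * g1 x"] power2_eq_square mult.commute)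
    qed
    define J where "J = (LBINT x:{0..T}. (g1 x)\<^sup>2 + (g2 x)\<^sup>2)"
    have cg2: "continuous_on {0..T} g2" unfolding g2_def by (intro continuous_intros cc cw cv)
    have cE: "continuous_on {0..T} E" by (rule ac_deriv_continuous[OF aE])
    have ch: "continuous_on {0..T} h" unfolding h_def using n0' by (intro continuous_intros cg2 cn) auto
    have ig1: "set_integrable lborel {0..T} (\<lambda>x. (g1 x)\<^sup>2)"
    proof -
      have "set_integrable lborel {0..T} (\<lambda>x. (1 * d x + (\<alpha> x * v x + \<beta> x * w x))\<^sup>2)"
        by (rule set_integrable_square_affine[OF _ _ id id2]) (intro continuous_intros cc cw cv)+
      then show ?thesis by (simp add: g1_def add.assoc)
    qed
    have ig2: "set_integrable lborel {0..T} (\<lambda>x. (g2 x)\<^sup>2)"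
      by (intro set_integrable_continuous_Icc continuous_intros cg2)
    have iJ: "set_integrable lborel {0..T} (\<lambda>x. (g1 x)\<^sup>2 + (g2 x)\<^sup>2)" using ig1 ig2 by simp
    have iE1: "set_integrable lborel {0..T} E1" by (rule ac_deriv_integrable[OF aE])
    have iE1': "set_integrable lborel {0..T} (\<lambda>x. (E1 x)\<^sup>2)"
    proof -
      have "set_integrable lborel {0..T} (\<lambda>x. (c1 x * d x + (c1 x * (\<alpha> x * v x + \<beta> x * w x) + c2 x * g2 x))\<^sup>2)"
        by (rule set_integrable_square_affine[OF _ _ id id2]) (intro continuous_intros cc cw cv cc1 cc2 cg2)+
      then show ?thesis by (simp add: E1 g1_def algebra_simps)
    qed
    have osc: "(E x - E 0)\<^sup>2 \<le> K1 * J" if x: "x \<in> {0..T}" for x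
    proof -
      have "\<bar>E x - E 0\<bar> = \<bar>LBINT y:{0..x}. E1 y\<bar>" using aE x by (simp add: ac_deriv_def)
      also have "\<dots> \<le> (LBINT y:{0..x}. \<bar>E1 y\<bar>)"
        unfolding set_lebesgue_integral_def
        using integral_norm_bound[of lborel "\<lambda>y. indicator {0..x} y *\<^sub>R E1 y"] by (simp add: abs_mult)
      also have "\<dots> \<le> (LBINT y:{0..T}. \<bar>E1 y\<bar>)"
        unfolding set_lebesgue_integral_def
      proof (rule integral_mono)
        show "integrable lborel (\<lambda>y. indicat_real {0..x} y *\<^sub>R \<bar>E1 y\<bar>)"
          using set_integrable_subset[OF set_integrable_abs[OF iE1], of "{0..x}"] x by (simp add: set_integrable_def)
        show "integrable lborel (\<lambda>y. indicat_real {0..T} y *\<^sub>R \<bar>E1 y\<bar>)"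
          using set_integrable_abs[OF iE1] by (simp add: set_integrable_def)
      qed (use x in \<open>auto simp: indicator_def\<close>)
      finally have "(E x - E 0)\<^sup>2 \<le> (LBINT y:{0..T}. \<bar>E1 y\<bar>)\<^sup>2"
        by (metis abs_ge_zero power2_abs power_mono)
      also have "\<dots> \<le> T * (LBINT y:{0..T}. \<bar>E1 y\<bar>\<^sup>2)"
        by (rule set_integral_square_le) (use set_integrable_abs[OF iE1] iE1' T in auto)
      also have "(LBINT y:{0..T}. \<bar>E1 y\<bar>\<^sup>2) \<le> (LBINT y:{0..T}. (2 * b\<^sup>2) * ((g1 y)\<^sup>2 + (g2 y)\<^sup>2))"
      proof (rule set_integral_mono)
        fix y assume y: "y \<in> {0..T}"
        have "\<bar>E1 y\<bar>\<^sup>2 \<le> 2 * (c1 y * g1 y)\<^sup>2 + 2 * (c2 y * g2 y)\<^sup>2"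
          unfolding E1 power2_abs by (rule square_add_le)
        also have "\<dots> \<le> 2 * (b\<^sup>2 * (g1 y)\<^sup>2) + 2 * (b\<^sup>2 * (g2 y)\<^sup>2)"
          by (intro add_mono mult_left_mono square_mult_le bb[OF y]) auto
        finally show "\<bar>E1 y\<bar>\<^sup>2 \<le> (2 * b\<^sup>2) * ((g1 y)\<^sup>2 + (g2 y)\<^sup>2)" by (simp add: algebra_simps)
      qed (use iE1' iJ in \<open>simp_all\<close>)
      also have "(LBINT y:{0..T}. (2 * b\<^sup>2) * ((g1 y)\<^sup>2 + (g2 y)\<^sup>2)) = (2 * b\<^sup>2) * J" by (simp add: J_def)
      finally show ?thesis using T by (simp add: K1_def algebra_simps)
    qed
    have h2: "(h x)\<^sup>2 \<le> b\<^sup>2 * (g2 x)\<^sup>2" if "x \<in> {0..T}" for x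
      using square_mult_le[OF bb(5)[OF that], of "g2 x"] by (simp add: h_def)
    \<comment> \<open>Splitting \<open>U1 * v\<close> into \<open>E 0\<close> times the square of
      \<open>U1\<close> plus a remainder \<open>r\<close> turns orthogonality into an equation for
      \<open>E 0\<close>, solvable because \<open>s > 0\<close>.\<close>
    have E0: "(E 0)\<^sup>2 \<le> (T * Z / s\<^sup>2) * J"
    proof -
      define r where "r = (\<lambda>x. (E x - E 0) * (U1 x)\<^sup>2 + h x * U x * U1 x)"
      have cr: "continuous_on {0..T} r" unfolding r_def by (intro continuous_intros cE ch cc)
      have "(LBINT x:{0..T}. U1 x * v x) = (LBINT x:{0..T}. E 0 * (U1 x)\<^sup>2 + r x)"
        by (rule set_lebesgue_integral_cong) (auto simp: r_def v_eq power2_eq_square algebra_simps)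
      also have "\<dots> = E 0 * s + (LBINT x:{0..T}. r x)"
        unfolding s_def
        by (subst set_integral_add(2))
          (auto intro!: set_integrable_continuous_Icc continuous_intros cr cc)
      finally have "E 0 * s = - (LBINT x:{0..T}. r x)" using orth by simp
      then have "(E 0)\<^sup>2 * s\<^sup>2 = (LBINT x:{0..T}. r x)\<^sup>2" by (metis power2_minus power_mult_distrib)
      also have "\<dots> \<le> T * (LBINT x:{0..T}. (r x)\<^sup>2)"
        by (intro set_integral_square_le set_integrable_continuous_Icc continuous_intros cr T)
      also have "(LBINT x:{0..T}. (r x)\<^sup>2) \<le> (LBINT x:{0..T}. 2 * b ^ 4 * K1 * J + (2 * b ^ 6) * ((g1 x)\<^sup>2 + (g2 x)\<^sup>2))"
      proof (rule set_integral_mono)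
        show "set_integrable lborel {0..T} (\<lambda>x. (r x)\<^sup>2)"
          by (intro set_integrable_continuous_Icc continuous_intros cr)
        show "set_integrable lborel {0..T} (\<lambda>x. 2 * b ^ 4 * K1 * J + (2 * b ^ 6) * ((g1 x)\<^sup>2 + (g2 x)\<^sup>2))"
          using iJ set_integrable_const_Icc by simp
        fix x assume x: "x \<in> {0..T}"
        have "(r x)\<^sup>2 \<le> 2 * (U1 x * (U1 x * (E x - E 0)))\<^sup>2 + 2 * (U x * (U1 x * h x))\<^sup>2"
          using square_add_le[of "U1 x * (U1 x * (E x - E 0))" "U x * (U1 x * h x)"]
          by (simp add: r_def power2_eq_square algebra_simps)
        also have "\<dots> \<le> 2 * (b\<^sup>2 * (b\<^sup>2 * (K1 * J))) + 2 * (b\<^sup>2 * (b\<^sup>2 * (b\<^sup>2 * (g2 x)\<^sup>2)))"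
          by (intro add_mono mult_left_mono order_trans[OF square_mult_le[OF bb(1)[OF x]]]
              order_trans[OF square_mult_le[OF bb(2)[OF x]]] osc[OF x] h2[OF x]) auto
        also have "\<dots> = 2 * b ^ 4 * K1 * J + (2 * b ^ 6) * (g2 x)\<^sup>2"
          by (simp add: power_numeral_reduce power2_eq_square)
        also have "\<dots> \<le> 2 * b ^ 4 * K1 * J + (2 * b ^ 6) * ((g1 x)\<^sup>2 + (g2 x)\<^sup>2)"
          using b0 by simp
        finally show "(r x)\<^sup>2 \<le> 2 * b ^ 4 * K1 * J + (2 * b ^ 6) * ((g1 x)\<^sup>2 + (g2 x)\<^sup>2)" .
      qed
      also have "\<dots> = Z * J"
        using T by (subst set_integral_affine_Icc[OF iJ]) (simp_all add: J_def[symmetric] Z_def algebra_simps)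
      finally have "(E 0)\<^sup>2 * s\<^sup>2 \<le> T * (Z * J)" using T by simp
      then show ?thesis using S by (simp add: s_def field_simps)
    qed
    have E2: "(E x)\<^sup>2 \<le> K3 * J" if x: "x \<in> {0..T}" for x
    proof -
      have "(E x)\<^sup>2 \<le> 2 * (E x - E 0)\<^sup>2 + 2 * (E 0)\<^sup>2" using square_add_le[of "E x - E 0" "E 0"] by simp
      also have "\<dots> \<le> 2 * (K1 * J) + 2 * ((T * Z / s\<^sup>2) * J)" by (intro add_mono mult_left_mono osc[OF x] E0) auto
      also have "\<dots> = K3 * J" by (simp add: K3_def algebra_simps)
      finally show ?thesis .
    qed
    have "(LBINT x:{0..T}. (v x)\<^sup>2 + (d x)\<^sup>2) \<le>
      (LBINT x:{0..T}. (1 + 6 * b\<^sup>2) * (2 * b\<^sup>2 * K3 * J) + (3 + (1 + 6 * b\<^sup>2) * (2 * b ^ 4)) * ((g1 x)\<^sup>2 + (g2 x)\<^sup>2))"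
    proof (rule set_integral_mono)
      have "set_integrable lborel {0..T} (\<lambda>x. (v x)\<^sup>2)" 
        by (intro set_integrable_continuous_Icc continuous_intros cv)
      then show "set_integrable lborel {0..T} (\<lambda>x. (v x)\<^sup>2 + (d x)\<^sup>2)" using id2 by simp
      show "set_integrable lborel {0..T} (\<lambda>x. (1 + 6 * b\<^sup>2) * (2 * b\<^sup>2 * K3 * J) + (3 + (1 + 6 * b\<^sup>2) * (2 * b ^ 4)) * ((g1 x)\<^sup>2 + (g2 x)\<^sup>2))"
        using iJ set_integrable_const_Icc by simp
      fix x assume x: "x \<in> {0..T}"
      define Q where "Q = 2 * (b\<^sup>2 * (K3 * J)) + 2 * (b\<^sup>2 * (b\<^sup>2 * (g2 x)\<^sup>2))"
      have "(v x)\<^sup>2 \<le> 2 * (U1 x * E x)\<^sup>2 + 2 * (U x * h x)\<^sup>2"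
        using square_add_le[of "U1 x * E x" "U x * h x"] by (simp add: v_eq[of x] mult.commute)
      also have "\<dots> \<le> Q" unfolding Q_def
        by (intro add_mono mult_left_mono order_trans[OF square_mult_le[OF bb(1)[OF x]]]
              order_trans[OF square_mult_le[OF bb(2)[OF x]]] E2[OF x] h2[OF x]) auto
      finally have v2: "(v x)\<^sup>2 \<le> Q" .
      have "(w x)\<^sup>2 \<le> 2 * (U x * E x)\<^sup>2 + 2 * (U1 x * h x)\<^sup>2"
        using square_add_le[of "U x * E x" "- (U1 x * h x)"] by (simp add: w_eq[of x] mult.commute)
      also have "\<dots> \<le> Q" unfolding Q_def
        by (intro add_mono mult_left_mono order_trans[OF square_mult_le[OF bb(1)[OF x]]]
              order_trans[OF square_mult_le[OF bb(2)[OF x]]] E2[OF x] h2[OF x]) auto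
      finally have w2: "(w x)\<^sup>2 \<le> Q" .
      have "(d x)\<^sup>2 = (g1 x + (- (\<alpha> x * v x) + - (\<beta> x * w x)))\<^sup>2" by (simp add: g1_def)
      \<comment> \<open>With \<open>x\<close>, \<open>y\<close>, \<open>z\<close> the three
        summands, the gap between the two sides is the sum of the squares of \<open>x - y\<close>,
        \<open>x - z\<close> and \<open>y - z\<close>.\<close>
      also have "\<dots> \<le> 3 * (g1 x)\<^sup>2 + 3 * (\<alpha> x * v x)\<^sup>2 + 3 * (\<beta> x * w x)\<^sup>2"
        using sum_squares_ge_zero[of "g1 x + \<alpha> x * v x" "g1 x + \<beta> x * w x"] zero_le_power2[of "\<alpha> x * v x - \<beta> x * w x"]
        by (simp add: power2_eq_square algebra_simps)
      also have "\<dots> \<le> 3 * (g1 x)\<^sup>2 + 3 * (b\<^sup>2 * Q) + 3 * (b\<^sup>2 * Q)"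
        by (intro add_mono mult_left_mono order_refl order_trans[OF square_mult_le[OF bb(3)[OF x]]]
              order_trans[OF square_mult_le[OF bb(4)[OF x]]] v2 w2) auto
      finally have "(v x)\<^sup>2 + (d x)\<^sup>2 \<le> (1 + 6 * b\<^sup>2) * Q + 3 * (g1 x)\<^sup>2" using v2 by (simp add: algebra_simps)
      also have "\<dots> \<le> (1 + 6 * b\<^sup>2) * (2 * b\<^sup>2 * K3 * J) + (3 + (1 + 6 * b\<^sup>2) * (2 * b ^ 4)) * ((g1 x)\<^sup>2 + (g2 x)\<^sup>2)"
      proof -
        have "Q = 2 * b\<^sup>2 * K3 * J + 2 * b ^ 4 * (g2 x)\<^sup>2"
          by (simp add: Q_def power_numeral_reduce power2_eq_square)
        moreover have "0 \<le> (1 + 6 * b\<^sup>2) * (2 * b ^ 4) * (g1 x)\<^sup>2" using b0 by simp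
        moreover have "0 \<le> 3 * (g2 x)\<^sup>2" by simp
        ultimately show ?thesis by (simp only: distrib_left distrib_right mult.assoc)
      qed
      finally show "(v x)\<^sup>2 + (d x)\<^sup>2 \<le> (1 + 6 * b\<^sup>2) * (2 * b\<^sup>2 * K3 * J) + (3 + (1 + 6 * b\<^sup>2) * (2 * b ^ 4)) * ((g1 x)\<^sup>2 + (g2 x)\<^sup>2)" .
    qed
    also have "\<dots> = M * J"
      using T by (subst set_integral_affine_Icc[OF iJ]) (simp_all add: J_def[symmetric] M_def algebra_simps)
    finally show "(LBINT x:{0..T}. (v x)\<^sup>2 + (d x)\<^sup>2)
        \<le> M * (LBINT x:{0..T}. (d x + \<alpha> x * v x + \<beta> x * w x)\<^sup>2 + (U x * v x - U1 x * w x)\<^sup>2)"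
      by (simp add: J_def g1_def g2_def)
  qed
qed

section \<open>The pointwise identity and the sign of the weight\<close>

lemma abs_mult_le:
  fixes a b :: real
  assumes "\<bar>a\<bar> \<le> A" "\<bar>b\<bar> \<le> B" shows "\<bar>a * b\<bar> \<le> A * B"
proof -
  have "0 \<le> A" using assms(1) abs_ge_zero[of a] by linarith
  then show ?thesis unfolding abs_mult by (intro mult_mono assms) auto
qed

text \<open>A second-order expansion in \<open>e\<close> with an explicit remainder. The variable
  \<open>y\<close> rescales \<open>\<psi> - m\<close> to the unit interval. After clearing the
  denominator \<open>D\<close>, which is at least 1, the error is \<open>e\<close> squared times a
  polynomial \<open>N\<close> bounded by 9.\<close>

lemma weight_expansion:
  fixes e m t y :: real
  assumes e: "0 < e" "e \<le> 1/24" and m: "\<bar>m - 1\<bar> \<le> e" and y: "0 \<le> y" "y \<le> 1" and t: "\<bar>t\<bar> \<le> 1"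
  defines "\<psi> \<equiv> m + e\<^sup>2 * y / 2" and "\<kappa> \<equiv> m + t * e"
    and "B \<equiv> m + e\<^sup>2 * y / 2 + t * e * (1 - y) - t\<^sup>2 * e\<^sup>2 * y * (1 - y) / 2"
  shows "\<bar>2 * m\<^sup>2 * B / (\<kappa> * \<psi> * (\<psi> + m)) - 1 + t * e * y\<bar> \<le> 9 * e\<^sup>2"
proof -
  \<comment> \<open>Writing \<open>m - 1\<close> as \<open>n * e\<close> with bounded
    \<open>n\<close> exposes the second power of \<open>e\<close> in terms such as
    \<open>t * e * y * (m - 1)\<close>.\<close>
  define n where "n = (m - 1) / e"
  have n: "m = 1 + n * e" "\<bar>n\<bar> \<le> 1" using e m by (auto simp: n_def abs_divide)
  have m': "23/24 \<le> m" "m \<le> 25/24" using m e by (auto simp: abs_if split: if_splits)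
  have te: "\<bar>t * e\<bar> \<le> 1/24" using abs_mult_le[OF t, of e "1/24"] e by simp
  have k: "22/24 \<le> \<kappa>" "\<kappa> \<le> 26/24" using te m' by (auto simp: \<kappa>_def abs_if split: if_splits)
  have e2: "0 \<le> e\<^sup>2" "e\<^sup>2 \<le> 1/576" using power_mono[OF e(2), of 2] e by (auto simp: power_divide)
  have ey: "0 \<le> e\<^sup>2 * y" "e\<^sup>2 * y \<le> 1/576"
    using mult_mono[OF e2(2) y(2)] e2 y by auto
  have \<psi>: "23/24 \<le> \<psi>" using m' ey by (simp add: \<psi>_def mult.commute)
  define D where "D = \<kappa> * \<psi> * (\<psi> + m)"
  have D: "D \<ge> 1"
  proof -
    have "22/24 * (23/24) \<le> \<kappa> * \<psi>" using k \<psi> by (intro mult_mono) auto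
    then have "22/24 * (23/24) * (46/24) \<le> \<kappa> * \<psi> * (\<psi> + m)" using \<psi> m' k by (intro mult_mono) auto
    then show ?thesis by (simp add: D_def)
  qed
  define N where "N = 2 * (m * m * (t * (y * n))) + m * m * y - m * m * (t * t * (y * (1 - y))) + 2 * (m * m * (t * t * y))
     - \<kappa> * ((1 - t * e * y) * (3 / 2 * (m * y) + e\<^sup>2 * y * y / 4))"
  have NB: "2 * m\<^sup>2 * B - D * (1 - t * e * y) = e\<^sup>2 * N"
    unfolding N_def D_def B_def \<kappa>_def \<psi>_def unfolding n(1)
    by (simp add: power2_eq_square field_simps)
  have am: "\<bar>m * m\<bar> \<le> 25/24 * (25/24)" by (rule abs_mult_le) (use m' in auto)
  have ay: "\<bar>y\<bar> \<le> 1" "\<bar>1 - y\<bar> \<le> 1" using y by auto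
  have tt: "\<bar>t * t\<bar> \<le> 1 * 1" by (intro abs_mult_le t)
  have b1: "\<bar>m * m * (t * (y * n))\<bar> \<le> 25/24 * (25/24) * (1 * (1 * 1))"
    by (intro abs_mult_le[OF am] abs_mult_le t n ay)
  have b2: "\<bar>m * m * y\<bar> \<le> 25/24 * (25/24) * 1" by (intro abs_mult_le[OF am] ay)
  have b3: "\<bar>m * m * (t * t * (y * (1 - y)))\<bar> \<le> 25/24 * (25/24) * (1 * 1 * (1 * 1))"
    by (rule abs_mult_le[OF am abs_mult_le[OF tt abs_mult_le[OF ay]]])
  have b4: "\<bar>m * m * (t * t * y)\<bar> \<le> 25/24 * (25/24) * (1 * 1 * 1)"
    by (rule abs_mult_le[OF am abs_mult_le[OF tt ay(1)]])
  have "\<bar>t * e * y\<bar> \<le> 1/24 * 1" by (rule abs_mult_le[OF te ay(1)])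
  then have c1: "\<bar>1 - t * e * y\<bar> \<le> 25/24" by linarith
  have my: "\<bar>m * y\<bar> \<le> 25/24 * 1" by (rule abs_mult_le) (use m' ay in auto)
  have "\<bar>e\<^sup>2 * y * y\<bar> \<le> 1/576 * 1" by (rule abs_mult_le) (use ey ay in auto)
  then have c2: "\<bar>3 / 2 * (m * y) + e\<^sup>2 * y * y / 4\<bar> \<le> 5/3" using my by linarith
  have b5: "\<bar>\<kappa> * ((1 - t * e * y) * (3 / 2 * (m * y) + e\<^sup>2 * y * y / 4))\<bar> \<le> 26/24 * (25/24 * (5/3))"
    by (rule abs_mult_le[OF _ abs_mult_le[OF c1 c2]]) (use k in auto)
  have "\<bar>N\<bar> \<le> 9" unfolding N_def using b1 b2 b3 b4 b5 by linarith
  have "2 * m\<^sup>2 * B / D - 1 + t * e * y = (2 * m\<^sup>2 * B - D * (1 - t * e * y)) / D"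
    using D by (simp add: field_simps)
  also have "\<dots> = e\<^sup>2 * N / D" by (simp add: NB)
  finally have "\<bar>2 * m\<^sup>2 * B / D - 1 + t * e * y\<bar> = e\<^sup>2 * \<bar>N\<bar> / D" using D by (simp add: abs_mult)
  also have "\<dots> \<le> e\<^sup>2 * 9 / 1" using D \<open>\<bar>N\<bar> \<le> 9\<close> by (intro frac_le mult_left_mono) auto
  finally show ?thesis by (simp add: D_def mult.commute)
qed

text \<open>With \<open>x = \<psi> - m\<close> and \<open>u2 = U\<^sup>2\<close> the expression below is the weight \<open>\<rho>\<close>. The term \<open>- \<theta>\<^sup>2 x\<close> in the
  free function \<open>\<theta> - \<theta>\<^sup>2 x\<close> is what removes the oscillation of \<open>\<rho>\<close> at leading order, leaving
  \<open>(1 - t\<^sup>2)/2\<close>; the constant 24 makes \<open>(1 - t\<^sup>2)/2 \<ge> 12 e\<close> beat the remainder, which is at most \<open>10.5 e\<close>.\<close>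

lemma weight_pos:
  fixes e m x t :: real
  assumes e: "0 < e" "e \<le> 1/24" and m: "\<bar>m - 1\<bar> \<le> e" and x: "0 \<le> x" "2 * x \<le> e\<^sup>2" and t: "\<bar>t\<bar> \<le> 1 - 24 * e"
  defines "\<theta> \<equiv> t / e" and "\<psi> \<equiv> m + x" and "u2 \<equiv> e\<^sup>2 - 2 * x" 
  shows "0 < 1 - (\<theta> - \<theta>\<^sup>2 * x) - \<theta>\<^sup>2 * u2 + 
     (2 * \<theta> - 1 + \<theta>\<^sup>2 * u2) * \<psi>\<^sup>2 / (\<psi> + m) * (\<psi> + u2 * (\<theta> - \<theta>\<^sup>2 * x)) / ((m + \<theta> * e\<^sup>2) * (\<psi> ^ 3 / m\<^sup>2))"
    (is "0 < ?\<rho>")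
proof -
  define y where "y = 2 * x / e\<^sup>2"
  have e2: "e\<^sup>2 > 0" using e by simp
  have y: "0 \<le> y" "y \<le> 1" using x e2 by (auto simp: y_def)
  have xy: "x = e\<^sup>2 * y / 2" using e by (simp add: y_def)
  have t1: "\<bar>t\<bar> \<le> 1" using t e by linarith
  have m': "m > 0" using m e by (auto simp: abs_if split: if_splits)
  have \<psi>: "\<psi> > 0" using m' x by (simp add: \<psi>_def)
  have "\<bar>t * e\<bar> \<le> 1 * (1/24)" by (rule abs_mult_le) (use t1 e in auto)
  then have k: "m + t * e > 0" using m e by (auto simp: abs_if split: if_splits)
  define B where "B = m + e\<^sup>2 * y / 2 + t * e * (1 - y) - t\<^sup>2 * e\<^sup>2 * y * (1 - y) / 2"
  define r where "r = 2 * m\<^sup>2 * B / ((m + t * e) * \<psi> * (\<psi> + m)) - 1 + t * e * y"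
  have r: "\<bar>r\<bar> \<le> 9 * e\<^sup>2"
    unfolding r_def \<psi>_def xy B_def by (rule weight_expansion[OF e m y t1])
  \<comment> \<open>Half of the factor \<open>2 * \<theta> - 1 + \<theta>\<^sup>2 * u2\<close>. It
    has size \<open>1 / e\<close>, which is why the remainder \<open>r\<close> is needed to order
    \<open>e\<close> squared.\<close>
  define h where "h = t / e - 1/2 + t * t * (1 - y) / 2"
  have Beq: "\<psi> + u2 * (\<theta> - \<theta>\<^sup>2 * x) = B"
    unfolding B_def \<theta>_def u2_def \<psi>_def xy using e by (simp add: field_simps power2_eq_square)
  have Heq: "2 * \<theta> - 1 + \<theta>\<^sup>2 * u2 = 2 * h"
    unfolding h_def \<theta>_def u2_def xy using e by (simp add: field_simps power2_eq_square)
  have keq: "m + \<theta> * e\<^sup>2 = m + t * e" using e by (simp add: \<theta>_def power2_eq_square)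
  have Q: "2 * h * \<psi>\<^sup>2 / (\<psi> + m) * B / ((m + t * e) * (\<psi> ^ 3 / m\<^sup>2))
      = h * (2 * m\<^sup>2 * B / ((m + t * e) * \<psi> * (\<psi> + m)))"
  proof -
    have "2 * h * \<psi>\<^sup>2 / s * B / (l * (\<psi> ^ 3 / m\<^sup>2)) = h * (2 * m\<^sup>2 * B / (l * \<psi> * s))"
      if "s > 0" "l > 0" for s l :: real
      using \<psi> m' that by (simp add: field_simps power2_eq_square power3_eq_cube)
    from this[of "\<psi> + m" "m + t * e"] show ?thesis using \<psi> m' k by simp
  qed
  have "?\<rho> = 1 - (\<theta> - \<theta>\<^sup>2 * x) - \<theta>\<^sup>2 * u2 + h * (1 - t * e * y + r)"
    unfolding Beq Heq keq Q by (simp add: r_def)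
  \<comment> \<open>The terms \<open>t / e\<close> cancel, and the \<open>y\<close>-dependent terms
    of order 1 add up to \<open>- t * t / 2\<close>, independent of \<open>y\<close>.\<close>
  also have "\<dots> = (1 - t * t) / 2 + (1/2 - t * t * (1 - y) / 2) * (t * y) * e + h * r"
    unfolding h_def \<theta>_def u2_def xy using e by (simp add: field_simps power2_eq_square)
  finally have eq: "?\<rho> = (1 - t * t) / 2 + (1/2 - t * t * (1 - y) / 2) * (t * y) * e + h * r" .
  have tt: "\<bar>t * t\<bar> \<le> 1 * 1" by (intro abs_mult_le t1)
  have tty: "\<bar>t * t * (1 - y)\<bar> \<le> 1 * 1 * 1" by (rule abs_mult_le[OF tt]) (use y in auto)
  have tty': "0 \<le> t * t * (1 - y)" using y by simp
  have a1: "\<bar>(1/2 - t * t * (1 - y) / 2) * (t * y) * e\<bar> \<le> 1/2 * (1 * 1) * e"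
    by (intro abs_mult_le) (use tty tty' t1 y e in auto)
  have "\<bar>h * e\<bar> \<le> 11/10"
  proof -
    have "h * e = t - e/2 + t * t * (1 - y) * e / 2" using e by (simp add: h_def field_simps)
    moreover have "\<bar>t * t * (1 - y) * e\<bar> \<le> 1 * 1 * 1 * (1/24)" by (rule abs_mult_le[OF tty]) (use e in auto)
    ultimately show ?thesis using t1 e by linarith
  qed
  moreover have "\<bar>r / e\<bar> \<le> 9 * e" using r e by (simp add: abs_divide field_simps power2_eq_square)
  ultimately have "\<bar>(h * e) * (r / e)\<bar> \<le> 11/10 * (9 * e)" by (rule abs_mult_le)
  then have a2: "\<bar>h * r\<bar> \<le> 10 * e" using e by simp
  have "t * t \<le> (1 - 24 * e) * \<bar>t\<bar>" 
    using mult_right_mono[OF t, of "\<bar>t\<bar>"] by (simp add: abs_mult[symmetric])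
  also have "\<dots> \<le> (1 - 24 * e) * (1 - 24 * e)" using t e by (intro mult_left_mono) auto
  finally have "24 * e * (2 - 24 * e) \<le> 1 - t * t" by (simp add: algebra_simps)
  moreover have "24 * e * 1 \<le> 24 * e * (2 - 24 * e)" using e by (intro mult_left_mono) auto
  ultimately have a3: "24 * e \<le> 1 - t * t" by linarith
  define P where "P = (1/2 - t * t * (1 - y) / 2) * (t * y) * e"
  have "\<bar>P\<bar> \<le> e / 2" using a1 unfolding P_def by simp
  moreover define S where "S = h * r"
  ultimately have "- P \<le> e / 2" "- S \<le> 10 * e" using a2 abs_le_D2 by blast+
  moreover define Z where "Z = t * t"
  ultimately have "0 < (1 - Z) / 2 + P + S" using a3 e by (simp add: field_simps)
  then show ?thesis unfolding eq P_def S_def Z_def .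
qed

text \<open>\<open>A'\<close>, \<open>B'\<close>, \<open>C'\<close>, \<open>Gp\<close> and \<open>- t\<close> stand for the derivatives of \<open>A\<close>, \<open>B\<close>, \<open>C\<close> along the wave and of \<open>G\<close>, \<open>F\<close> with
  respect to \<open>\<psi>\<close>. \<open>K\<close> says that \<open>(U, U', U'')\<close> annihilates the first square, and \<open>E4\<close> is the
  derivative of \<open>K\<close> with respect to \<open>\<psi>\<close>.\<close>

lemma density_identity:
  fixes u u1 \<psi> \<kappa> P F G Gp t w v d :: real
  assumes nz: "\<kappa> \<noteq> 0" "P \<noteq> 0"
    and B: "B = \<psi> + u\<^sup>2 * F" and K: "\<kappa> = B + u1\<^sup>2 * G"
    and E4: "2 * F - 1 + t * u\<^sup>2 = 2 * G / P + u1\<^sup>2 * Gp"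
    and E5: "1 - u1\<^sup>2 = \<psi> / P"
    and \<rho>: "\<rho> = 1 - F - t * u\<^sup>2 + G * B / (\<kappa> * P)"
    and A: "A = u * u1 * G" and C: "C = - u * u1 * F"
    and A': "A' = u1\<^sup>2 * G - u\<^sup>2 / P * G - u\<^sup>2 * u1\<^sup>2 * Gp"
    and B': "B' = - u * u1 + 2 * u * u1 * F + t * u ^ 3 * u1"
    and C': "C' = - u1\<^sup>2 * F + u\<^sup>2 / P * F - t * u\<^sup>2 * u1\<^sup>2"
  shows "w\<^sup>2 - (\<psi> + \<kappa>) * v\<^sup>2 + \<kappa> * P * d\<^sup>2
      + (A' * v\<^sup>2 + A * (2 * v * d) + 2 * (B' * (w * v) + B * (v * v + w * d)) + (C' * w\<^sup>2 + C * (2 * w * v)))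
    = \<kappa> * P * (d + A / (\<kappa> * P) * v + B / (\<kappa> * P) * w)\<^sup>2 + \<rho> * (u * v - u1 * w)\<^sup>2"
proof -
  define p where "p = 1 / P"
  define k where "k = 1 / (\<kappa> * P)"
  have kp: "\<kappa> * k = p" and qk: "\<kappa> * P * k = 1" using nz by (auto simp: k_def p_def)
  have E4': "2 * F - 1 + t * u\<^sup>2 = 2 * G * p + u1\<^sup>2 * Gp" using E4 by (simp add: p_def)
  have \<rho>': "\<rho> = 1 - F - t * u\<^sup>2 + G * B * k" using \<rho> by (simp add: k_def)
  \<comment> \<open>\<open>GB\<close> and \<open>BB\<close> are the relation \<open>K\<close>
    multiplied by \<open>G * k\<close> and by \<open>B * k\<close>.\<close>
  have GB: "G * B * k = G * p - u1\<^sup>2 * G\<^sup>2 * k"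
    unfolding kp[symmetric] K by (simp add: algebra_simps power2_eq_square)
  have BB: "B\<^sup>2 * k + u1\<^sup>2 * (G * B * k) = B * p"
    unfolding kp[symmetric] K by (simp add: algebra_simps power2_eq_square)
  \<comment> \<open>Comparison of coefficients: facts 1, 2 and 3 treat \<open>v * v\<close>,
    \<open>w * v\<close> and \<open>w * w\<close>; the terms containing \<open>d\<close> are
    absorbed at the end by completing the square.\<close>
  have "- (\<psi> + \<kappa>) + A' + 2 * B = u\<^sup>2 * (F - G * p - u1\<^sup>2 * Gp)"
    unfolding K A' B p_def by (simp add: algebra_simps)
  also have "F - G * p - u1\<^sup>2 * Gp = 1 - F - t * u\<^sup>2 + G * p" using E4' by simp
  also have "u\<^sup>2 * (1 - F - t * u\<^sup>2 + G * p) = A\<^sup>2 * k + \<rho> * u\<^sup>2"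
    unfolding \<rho>' GB A by (simp add: algebra_simps power2_eq_square)
  finally have 1: "- (\<psi> + \<kappa>) + A' + 2 * B = A\<^sup>2 * k + \<rho> * u\<^sup>2" .
  have 2: "2 * B' + 2 * C = 2 * A * B * k - 2 * \<rho> * u * u1"
    unfolding \<rho>' B' C A by (simp add: algebra_simps power2_eq_square power3_eq_cube)
  have "1 + C' = B * p + u1\<^sup>2 * (1 - F - t * u\<^sup>2)"
    using E5 unfolding C' B p_def by (simp add: algebra_simps add_divide_distrib)
  also have "\<dots> = B\<^sup>2 * k + \<rho> * u1\<^sup>2"
    unfolding \<rho>' BB[symmetric] by (simp add: algebra_simps)
  finally have 3: "1 + C' = B\<^sup>2 * k + \<rho> * u1\<^sup>2" .
  have "w\<^sup>2 - (\<psi> + \<kappa>) * v\<^sup>2 + \<kappa> * P * d\<^sup>2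
      + (A' * v\<^sup>2 + A * (2 * v * d) + 2 * (B' * (w * v) + B * (v * v + w * d)) + (C' * w\<^sup>2 + C * (2 * w * v)))
    = (- (\<psi> + \<kappa>) + A' + 2 * B) * v\<^sup>2 + (2 * B' + 2 * C) * (w * v) + (1 + C') * w\<^sup>2
      + \<kappa> * P * d\<^sup>2 + 2 * A * (v * d) + 2 * B * (w * d)"
    by (simp add: algebra_simps power2_eq_square)
  also have "\<dots> = \<kappa> * P * d\<^sup>2 + 2 * (A * v + B * w) * d + k * (A * v + B * w)\<^sup>2 + \<rho> * (u * v - u1 * w)\<^sup>2"
    unfolding 1 2 3 by (simp add: algebra_simps power2_eq_square)
  also have "\<kappa> * P * d\<^sup>2 + 2 * (A * v + B * w) * d + k * (A * v + B * w)\<^sup>2 = \<kappa> * P * (d + k * (A * v + B * w))\<^sup>2"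
  proof -
    have "\<kappa> * P * (d + k * (A * v + B * w))\<^sup>2
      = \<kappa> * P * d\<^sup>2 + 2 * (\<kappa> * P * k) * (A * v + B * w) * d + (\<kappa> * P * k) * k * (A * v + B * w)\<^sup>2"
      by (simp add: algebra_simps power2_eq_square)
    then show ?thesis unfolding qk by simp
  qed
  finally show ?thesis by (simp add: k_def algebra_simps)
qed

text \<open>Condition \<open>E4\<close> of \<open>density_identity\<close> for the multipliers used
  below. The factor \<open>\<psi> + m\<close> of \<open>\<psi>\<^sup>2 - m\<^sup>2\<close> cancels;
  the terms with \<open>H\<close> add up to \<open>H\<close> because \<open>2 * m\<^sup>2 + (\<psi>
  - m) * (\<psi> + 2 * m) = \<psi> * (\<psi> + m)\<close>.\<close>

lemma multiplier_derivative_identity: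
  fixes \<psi> m t H u2 u12 \<theta> :: real
  assumes \<psi>: "\<psi> > 0" "m > 0" and u12: "u12 = (\<psi>\<^sup>2 - m\<^sup>2) / \<psi>\<^sup>2" and H: "H = 2 * \<theta> - 1 + \<theta>\<^sup>2 * u2"
  shows "2 * (\<theta> - \<theta>\<^sup>2 * (\<psi> - m)) - 1 + \<theta>\<^sup>2 * u2
     = 2 * (H * \<psi>\<^sup>2 / (\<psi> + m)) / (\<psi> ^ 3 / m\<^sup>2) + u12 * (- 2 * \<theta>\<^sup>2 * \<psi>\<^sup>2 / (\<psi> + m) + H * (\<psi>\<^sup>2 + 2 * m * \<psi>) / (\<psi> + m)\<^sup>2)"
proof -
  define s where "s = \<psi> + m"
  have s: "s > 0" "m = s - \<psi>" using \<psi> by (auto simp: s_def)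
  have "2 * (H * \<psi>\<^sup>2 / s) / (\<psi> ^ 3 / m\<^sup>2) = 2 * H * m\<^sup>2 / (\<psi> * s)"
    using \<psi> s by (simp add: field_simps power2_eq_square power3_eq_cube)
  moreover have u: "u12 = (\<psi> - m) * s / \<psi>\<^sup>2" using u12 by (simp add: s_def power2_eq_square algebra_simps)
  have "u12 * (- 2 * \<theta>\<^sup>2 * \<psi>\<^sup>2 / s) = - 2 * \<theta>\<^sup>2 * (\<psi> - m)" unfolding u using \<psi> s(1) by simp
  moreover have "u12 * (H * (\<psi>\<^sup>2 + 2 * m * \<psi>) / s\<^sup>2) = H * (\<psi> - m) * (\<psi> + 2 * m) / (\<psi> * s)"
    unfolding u using \<psi> s(1) by (simp add: divide_simps power2_eq_square) (simp add: algebra_simps)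
  moreover have "2 * H * m\<^sup>2 / (\<psi> * s) + H * (\<psi> - m) * (\<psi> + 2 * m) / (\<psi> * s) = H"
  proof -
    have "2 * H * m\<^sup>2 + H * (\<psi> - m) * (\<psi> + 2 * m) = H * (\<psi> * s)"
      by (simp add: s_def algebra_simps power2_eq_square)
    then show ?thesis using \<psi> s(1) by (simp add: add_divide_distrib[symmetric])
  qed
  ultimately show ?thesis unfolding s_def[symmetric] by (simp add: distrib_left H algebra_simps)
qed

section \<open>The periodic wave\<close>

lemma continuous_on_Icc_pos_lower_bound:
  fixes f :: "real \<Rightarrow> real"
  assumes "continuous_on {a..b} f" "a \<le> b" "\<And>x. x \<in> {a..b} \<Longrightarrow> f x > 0"
  obtains c where "c > 0" "\<And>x. x \<in> {a..b} \<Longrightarrow> c \<le> f x"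
proof -
  obtain y where "y \<in> {a..b}" "\<forall>x\<in>{a..b}. f y \<le> f x"
    using continuous_attains_inf[OF compact_Icc _ assms(1)] assms(2) by auto
  then show ?thesis using that[of "f y"] assms(3) by blast
qed

lemma periodic_multiple:
  fixes f :: "real \<Rightarrow> real"
  assumes "\<And>z. f (z + p) = f z" shows "f (p * real N) = f 0"
proof (induction N)
  case (Suc N)
  have "f (p * real (Suc N)) = f (p * real N + p)" by (simp add: algebra_simps)
  then show ?case using assms Suc by simp
qed simp

text \<open>Positivity of \<open>I\<close> excludes the zero solution and gives
  \<open>m < \<gamma>\<close>.\<close>

locale wave =
  fixes \<gamma> I :: real and U :: "real \<Rightarrow> real"
  assumes wave: "periodic_wave \<gamma> I U" and I_pos: "I > 0" and \<gamma>_pos: "\<gamma> > 0"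
begin

definition "U1 = deriv U"
definition "\<psi> z = \<gamma> - (U z)\<^sup>2 / 2"
definition "m = sqrt (\<gamma>\<^sup>2 - 2 * I)"
text \<open>By the energy relation this is \<open>m * (1 - (U1 z)\<^sup>2) powr (-3/2)\<close>: the
  coefficient of the squared weak derivative once \<open>c / (2 * m)\<close> is factored
  out.\<close>

definition "P z = \<psi> z ^ 3 / m\<^sup>2"

lemma smooth_U: "smooth U" and per_U: "U (z + 2 * pi) = U z"
  using wave by (auto simp: periodic_wave_def periodic_def)

lemma m_pos: "m > 0" and m2: "m\<^sup>2 = \<gamma>\<^sup>2 - 2 * I" and m_lt: "m < \<gamma>"
proof -
  have "\<gamma>\<^sup>2 - 2 * I > 0" using wave by (simp add: periodic_wave_def)
  then show "m > 0" "m\<^sup>2 = \<gamma>\<^sup>2 - 2 * I" by (auto simp: m_def)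
  then show "m < \<gamma>" by (intro power_less_imp_less_base[of m 2 \<gamma>]) (use I_pos \<gamma>_pos in auto)
qed

lemma \<psi>_pos: "\<psi> z > 0"
proof -
  have "\<bar>U z\<bar> < sqrt (2 * \<gamma>)" using wave by (simp add: periodic_wave_def)
  then have "\<bar>U z\<bar>\<^sup>2 < (sqrt (2 * \<gamma>))\<^sup>2" by (intro power_strict_mono) auto
  then show ?thesis using \<gamma>_pos by (simp add: \<psi>_def)
qed

lemma P_pos: "P z > 0" using \<psi>_pos m_pos by (simp add: P_def)

text \<open>The potential part of \<open>I\<close> equals half of
  \<open>\<gamma>\<^sup>2 - (\<psi> z)\<^sup>2\<close>, by completing the square in the square of
  \<open>U\<close>.\<close>

lemma energy: "(\<psi> z)\<^sup>2 * (1 - (U1 z)\<^sup>2) = m\<^sup>2"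
proof -
  have "I = (\<psi> z)\<^sup>2 * (U1 z)\<^sup>2 / 2 + \<gamma> / 2 * (U z)\<^sup>2 - (U z) ^ 4 / 8"
    using wave by (simp add: periodic_wave_def \<psi>_def U1_def)
  moreover have "(\<psi> z)\<^sup>2 = \<gamma>\<^sup>2 - 2 * (\<gamma> / 2 * (U z)\<^sup>2 - (U z) ^ 4 / 8)"
    by (simp add: \<psi>_def power2_diff power_divide power_mult[symmetric])
  ultimately show ?thesis unfolding m2 right_diff_distrib by linarith
qed

lemma U1_sq: "(U1 z)\<^sup>2 = ((\<psi> z)\<^sup>2 - m\<^sup>2) / (\<psi> z)\<^sup>2"
  using energy[of z] \<psi>_pos[of z] by (simp add: field_simps)

lemma m_le_\<psi>: "m \<le> \<psi> z"
proof -
  have "(\<psi> z)\<^sup>2 - m\<^sup>2 = (\<psi> z)\<^sup>2 * (U1 z)\<^sup>2" using energy[of z] by (simp add: algebra_simps)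
  also have "\<dots> \<ge> 0" by simp
  finally show ?thesis by (intro power2_le_imp_le[of m "\<psi> z"]) (use \<psi>_pos[of z] in auto)
qed

lemma U_nontrivial: "(U z)\<^sup>2 + (U1 z)\<^sup>2 > 0"
proof (rule ccontr)
  assume "\<not> ?thesis"
  then have "U z = 0 \<and> U1 z = 0" by (simp add: sum_power2_gt_zero_iff)
  moreover have "I = (\<psi> z)\<^sup>2 * (U1 z)\<^sup>2 / 2 + \<gamma> / 2 * (U z)\<^sup>2 - (U z) ^ 4 / 8"
    using wave by (simp add: periodic_wave_def \<psi>_def U1_def)
  ultimately have "I = 0" by simp
  then show False using I_pos by simp
qed

lemma dU: "(U has_real_derivative U1 z) (at z)"
  unfolding U1_def by (rule smooth_DERIV[OF smooth_U])

lemma d\<psi>: "(\<psi> has_real_derivative - U z * U1 z) (at z)"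
  unfolding \<psi>_def[abs_def] by (auto intro!: derivative_eq_intros dU)

text \<open>The wave equation solved for the second derivative: the product rule on its divergence
  form, followed by elimination of \<open>1 - (U1 z)\<^sup>2\<close> through
  \<open>energy\<close>.\<close>

lemma dU1: "(U1 has_real_derivative - U z / P z) (at z)"
proof -
  have 1: "(U1 has_real_derivative deriv U1 z) (at z)"
    unfolding U1_def by (rule smooth_DERIV[OF smooth_deriv[OF smooth_U]])
  have "((\<lambda>z. \<psi> z * U1 z) has_real_derivative - U z * U1 z * U1 z + deriv U1 z * \<psi> z) (at z)"
    by (rule DERIV_mult[OF d\<psi> 1])
  moreover have "((\<lambda>z. \<psi> z * U1 z) has_real_derivative - U z) (at z)"
    using wave by (simp add: periodic_wave_def \<psi>_def U1_def)
  ultimately have "- U z * U1 z * U1 z + deriv U1 z * \<psi> z = - U z" by (rule DERIV_unique)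
  then have "deriv U1 z * \<psi> z = - U z * (1 - (U1 z)\<^sup>2)" by (simp add: algebra_simps power2_eq_square)
  then have "deriv U1 z * \<psi> z * (\<psi> z)\<^sup>2 = - U z * m\<^sup>2"
    using energy[of z] by (metis (no_types, opaque_lifting) mult.assoc mult.commute)
  then have "deriv U1 z = - U z / P z"
    using \<psi>_pos[of z] m_pos by (simp add: P_def field_simps power2_eq_square power3_eq_cube)
  then show ?thesis using 1 by simp
qed

lemma per_U1: "U1 (z + 2 * pi) = U1 z"
proof -
  have "((\<lambda>z. U (z + 2 * pi)) has_real_derivative U1 (z + 2 * pi)) (at z)"
    using DERIV_shift[of U "U1 (z + 2 * pi)" z "2 * pi"] dU by blast
  then show ?thesis using DERIV_unique[OF dU] unfolding per_U by metis
qed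

lemma cont_U: "continuous_on A U" and cont_U1: "continuous_on A U1" and cont_\<psi>: "continuous_on A \<psi>"
  using dU dU1 d\<psi> by (auto intro!: continuous_at_imp_continuous_on DERIV_isCont)

lemma cont_P: "continuous_on A P"
  unfolding P_def[abs_def] using m_pos by (intro continuous_intros cont_\<psi>) auto

text \<open>If \<open>U1\<close> vanished on the interval, so would its derivative at the midpoint;
  by \<open>dU1\<close> then \<open>U\<close> vanishes there too, against
  \<open>U_nontrivial\<close>.\<close>

lemma U1_integral_pos:
  assumes "T > 0" shows "(LBINT x:{0..T}. (U1 x)\<^sup>2) > 0"
proof (rule ccontr)
  assume *: "\<not> ?thesis"
  have i: "set_integrable lborel {0..T} (\<lambda>x. (U1 x)\<^sup>2)"
    by (intro set_integrable_continuous_Icc continuous_intros cont_U1)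
  have "0 \<le> (LBINT x:{0..T}. (U1 x)\<^sup>2)"
    unfolding set_lebesgue_integral_def by (rule integral_nonneg_AE) auto
  with * have "integral {0..T} (\<lambda>x. (U1 x)\<^sup>2) = 0"
    using set_borel_integral_eq_integral(2)[OF i] by simp
  then have z: "\<forall>x\<in>{0..T}. (U1 x)\<^sup>2 = 0"
    by (subst (asm) integral_eq_0_iff) (use assms in \<open>auto intro!: continuous_intros cont_U1\<close>)
  have "(U1 has_real_derivative 0) (at (T/2))"
  proof (rule has_field_derivative_transform_within_open[where f="\<lambda>_. 0" and S="{0<..<T}"])
    show "((\<lambda>_. 0) has_real_derivative 0) (at (T/2))" by simp
  qed (use assms z in auto)
  then have "- U (T/2) / P (T/2) = 0" using dU1 DERIV_unique by blast
  then have "U (T/2) = 0" using P_pos[of "T/2"] by simp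
  moreover have "U1 (T/2) = 0" using z assms by auto
  ultimately show False using U_nontrivial[of "T/2"] by simp
qed

section \<open>The quadratic form at a fixed wave\<close>

text \<open>Isolates the dependence on \<open>c\<close>: \<open>f\<close> and \<open>g\<close> do
  not involve it. This serves both the passage to \<open>\<kappa> = c / (2 * m)\<close> and the
  interpolation between two values of \<open>c\<close>.\<close>

lemma delta2_affine:
  assumes v: "has_weak_deriv T v (weak_deriv T v)"
    and w: "continuous_on {0..T} (zero_mean_antideriv T v)"
  defines "f \<equiv> \<lambda>x. (zero_mean_antideriv T v x)\<^sup>2 - \<psi> x * (v x)\<^sup>2"
    and "g \<equiv> \<lambda>x. P x * (weak_deriv T v x)\<^sup>2 - (v x)\<^sup>2"
  shows "set_integrable lborel {0..T} f" "set_integrable lborel {0..T} g"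
    "delta2_Lambda T c \<gamma> I U v = (LBINT x:{0..T}. f x) + c / (2 * m) * (LBINT x:{0..T}. g x)"
proof -
  have i: "set_integrable lborel {0..T} (\<lambda>x. (v x)\<^sup>2)" "set_integrable lborel {0..T} (\<lambda>x. (weak_deriv T v x)\<^sup>2)"
    using v by (auto simp: has_weak_deriv_def L2_per_def)
  show f: "set_integrable lborel {0..T} f" unfolding f_def
    by (intro set_integral_diff set_integrable_continuous_mult cont_\<psi> i set_integrable_continuous_Icc continuous_intros w)
  show g: "set_integrable lborel {0..T} g" unfolding g_def
    by (intro set_integral_diff set_integrable_continuous_mult cont_P i)
  have m: "(\<gamma>\<^sup>2 - 2 * I) powr (1 / 2) = m" 
    unfolding m_def using m_pos m2 by (intro powr_half_sqrt) (metis zero_le_power2)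
  \<comment> \<open>The base is the square of \<open>m / \<psi> z\<close> by \<open>energy\<close>,
    so the fractional power becomes a cube.\<close>
  have pw: "(1 - (deriv U z)\<^sup>2) powr (3 / 2) = (m / \<psi> z) ^ 3" for z
  proof -
    have "1 - (deriv U z)\<^sup>2 = (m / \<psi> z)\<^sup>2"
      using energy[of z] \<psi>_pos[of z] by (simp add: U1_def field_simps)
    also have "\<dots> = (m / \<psi> z) powr 2" using m_pos \<psi>_pos[of z] by (simp add: powr_numeral)
    finally have "(1 - (deriv U z)\<^sup>2) powr (3 / 2) = (m / \<psi> z) powr 3" by (simp add: powr_powr)
    then show ?thesis using m_pos \<psi>_pos[of z] by (simp add: powr_numeral)
  qed
  have "delta2_Lambda T c \<gamma> I U v = (LBINT x:{0..T}. f x + c / (2 * m) * g x)"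
    unfolding delta2_Lambda_def m pw
  proof (rule set_lebesgue_integral_cong, goal_cases)
    case 2
    show ?case
    proof (intro allI impI)
      fix z
      have "c * (weak_deriv T v z)\<^sup>2 / (2 * (m / \<psi> z) ^ 3) = c / (2 * m) * (P z * (weak_deriv T v z)\<^sup>2)"
        using m_pos \<psi>_pos[of z] by (simp add: P_def field_simps power2_eq_square power3_eq_cube)
      moreover have "c * (v z)\<^sup>2 / (2 * m) = c / (2 * m) * (v z)\<^sup>2" by simp
      ultimately show "(zero_mean_antideriv T v z)\<^sup>2 - (\<gamma> - (U z)\<^sup>2 / 2) * (v z)\<^sup>2 - c * (v z)\<^sup>2 / (2 * m)
          + c * (weak_deriv T v z)\<^sup>2 / (2 * (m / \<psi> z) ^ 3) = f z + c / (2 * m) * g z"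
        by (simp only: f_def g_def \<psi>_def right_diff_distrib)
    qed
  qed simp
  also have "\<dots> = (LBINT x:{0..T}. f x) + c / (2 * m) * (LBINT x:{0..T}. g x)"
    using f g by simp
  finally show "delta2_Lambda T c \<gamma> I U v = (LBINT x:{0..T}. f x) + c / (2 * m) * (LBINT x:{0..T}. g x)" .
qed

text \<open>Here the free function is \<open>F\<close>, and \<open>\<theta>\<close> is its value
  where \<open>\<psi> = m\<close>. At such points \<open>U1\<close> vanishes, so
  \<open>\<kappa> = B + (U1 z)\<^sup>2 * G\<close> forces the stated value of
  \<open>\<kappa>\<close>. The quadratic form then equals the integral of the two squares.\<close>

lemma form_ge_wronskian_form:
  fixes \<theta> :: real
  defines "\<kappa> \<equiv> m + \<theta> * (2 * (\<gamma> - m))"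
    and "F \<equiv> \<lambda>z. \<theta> - \<theta>\<^sup>2 * (\<psi> z - m)"
    and "G \<equiv> \<lambda>z. (2 * \<theta> - 1 + \<theta>\<^sup>2 * (U z)\<^sup>2) * (\<psi> z)\<^sup>2 / (\<psi> z + m)"
  defines "B \<equiv> \<lambda>z. \<psi> z + (U z)\<^sup>2 * F z"
  defines "\<rho> \<equiv> \<lambda>z. 1 - F z - \<theta>\<^sup>2 * (U z)\<^sup>2 + G z * B z / (\<kappa> * P z)"
  assumes \<kappa>: "\<kappa> > 0" and \<rho>: "\<And>z. \<rho> z > 0" and T: "T = 2 * pi * real N" "N \<ge> 1"
  obtains C where "C > 0"
    "\<And>v. v \<in> H1_per_zero T \<Longrightarrow> L2_inner T (deriv U) v = 0 \<Longrightarrow>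
       C * (H1_norm T v)\<^sup>2 \<le> delta2_Lambda T (2 * m * \<kappa>) \<gamma> I U v"
proof -
  have T0: "T > 0" using T by simp
  \<comment> \<open>The derivative of \<open>G\<close> with respect to \<open>\<psi>\<close>, where
    the square of \<open>U\<close> counts as \<open>2 * (\<gamma> - \<psi>)\<close>.\<close>
  define Gp where "Gp = (\<lambda>z. - 2 * \<theta>\<^sup>2 * (\<psi> z)\<^sup>2 / (\<psi> z + m)
     + (2 * \<theta> - 1 + \<theta>\<^sup>2 * (U z)\<^sup>2) * ((\<psi> z)\<^sup>2 + 2 * m * \<psi> z) / (\<psi> z + m)\<^sup>2)"
  define A where "A = (\<lambda>z. U z * U1 z * G z)"
  define C where "C = (\<lambda>z. - U z * U1 z * F z)"
  define A' where "A' = (\<lambda>z. (U1 z)\<^sup>2 * G z - (U z)\<^sup>2 / P z * G z - (U z)\<^sup>2 * (U1 z)\<^sup>2 * Gp z)"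
  define B' where "B' = (\<lambda>z. - U z * U1 z + 2 * U z * U1 z * F z + \<theta>\<^sup>2 * U z ^ 3 * U1 z)"
  define C' where "C' = (\<lambda>z. - (U1 z)\<^sup>2 * F z + (U z)\<^sup>2 / P z * F z - \<theta>\<^sup>2 * (U z)\<^sup>2 * (U1 z)\<^sup>2)"
  define \<alpha> where "\<alpha> = (\<lambda>z. A z / (\<kappa> * P z))"
  define \<beta> where "\<beta> = (\<lambda>z. B z / (\<kappa> * P z))"
  have sp: "\<psi> z + m > 0" for z using \<psi>_pos[of z] m_pos by simp
  have dF: "(F has_real_derivative \<theta>\<^sup>2 * (U z * U1 z)) (at z)" for z
    unfolding F_def by (auto intro!: derivative_eq_intros d\<psi>)
  have dG: "(G has_real_derivative Gp z * (- U z * U1 z)) (at z)" for z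
  proof -
    have "((\<lambda>z. (2 * \<theta> - 1 + \<theta>\<^sup>2 * (U z)\<^sup>2) * (\<psi> z)\<^sup>2) has_real_derivative
       \<theta>\<^sup>2 * (2 * U z * U1 z) * (\<psi> z)\<^sup>2 + (2 * \<theta> - 1 + \<theta>\<^sup>2 * (U z)\<^sup>2) * (2 * \<psi> z * (- U z * U1 z))) (at z)"
      by (auto intro!: derivative_eq_intros dU d\<psi>)
    moreover have "((\<lambda>z. \<psi> z + m) has_real_derivative - U z * U1 z) (at z)"
      using DERIV_add[OF d\<psi> DERIV_const[of m]] by simp
    ultimately have 1: "(G has_real_derivative ((\<theta>\<^sup>2 * (2 * U z * U1 z) * (\<psi> z)\<^sup>2 + (2 * \<theta> - 1 + \<theta>\<^sup>2 * (U z)\<^sup>2) * (2 * \<psi> z * (- U z * U1 z))) * (\<psi> z + m)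
        - (2 * \<theta> - 1 + \<theta>\<^sup>2 * (U z)\<^sup>2) * (\<psi> z)\<^sup>2 * (- U z * U1 z)) / ((\<psi> z + m) * (\<psi> z + m))) (at z)"
      unfolding G_def by (rule DERIV_divide) (use sp[of z] in simp)
    have "((\<theta>\<^sup>2 * (2 * u * u1) * p\<^sup>2 + H * (2 * p * (- u * u1))) * s - H * p\<^sup>2 * (- u * u1)) / (s * s)
        = (- 2 * \<theta>\<^sup>2 * p\<^sup>2 / s + H * (p\<^sup>2 + 2 * m * p) / s\<^sup>2) * (- u * u1)"
      if "s > 0" "s = p + m" for u u1 p H s :: real
    proof -
      have "2 * p * s - p\<^sup>2 = p\<^sup>2 + 2 * m * p" using that by (simp add: power2_eq_square algebra_simps)
      then have "(- 2 * \<theta>\<^sup>2 * p\<^sup>2 / s + H * (p\<^sup>2 + 2 * m * p) / s\<^sup>2) = (- 2 * \<theta>\<^sup>2 * p\<^sup>2 * s + H * (2 * p * s - p\<^sup>2)) / (s * s)"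
        using that(1) by (simp add: add_divide_distrib diff_divide_distrib power2_eq_square)
      then show ?thesis by (simp add: algebra_simps)
    qed
    from this[OF sp[of z] refl] have "((\<theta>\<^sup>2 * (2 * U z * U1 z) * (\<psi> z)\<^sup>2 + (2 * \<theta> - 1 + \<theta>\<^sup>2 * (U z)\<^sup>2) * (2 * \<psi> z * (- U z * U1 z))) * (\<psi> z + m)
        - (2 * \<theta> - 1 + \<theta>\<^sup>2 * (U z)\<^sup>2) * (\<psi> z)\<^sup>2 * (- U z * U1 z)) / ((\<psi> z + m) * (\<psi> z + m)) = Gp z * (- U z * U1 z)"
      unfolding Gp_def .
    then show ?thesis using 1 by simp
  qed
  have dA: "(A has_real_derivative A' z) (at z)" for z
    unfolding A_def A'_def
    by (auto intro!: derivative_eq_intros dU dU1 dG simp: power2_eq_square algebra_simps)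
  have dB: "(B has_real_derivative B' z) (at z)" for z
    unfolding B_def B'_def
    by (auto intro!: derivative_eq_intros dU d\<psi> dF simp: power2_eq_square power3_eq_cube algebra_simps)
  have dC: "(C has_real_derivative C' z) (at z)" for z
    unfolding C_def C'_def
    by (auto intro!: derivative_eq_intros dU dU1 dF simp: power2_eq_square algebra_simps)
  note cc = cont_U cont_U1 cont_\<psi> cont_P
  have P0: "P z \<noteq> 0" "\<psi> z + m \<noteq> 0" for z using P_pos[of z] sp[of z] by auto
  have cF: "continuous_on X F" for X unfolding F_def by (intro continuous_intros cc)
  have cG: "continuous_on X G" for X unfolding G_def by (intro continuous_intros cc) (use P0 in auto)
  have cGp: "continuous_on X Gp" for X unfolding Gp_def by (intro continuous_intros cc) (use P0 in auto)
  have cB: "continuous_on X B" for X unfolding B_def by (intro continuous_intros cc cF)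
  have cA: "continuous_on X A" for X unfolding A_def by (intro continuous_intros cc cG)
  have cA': "continuous_on X A'" for X unfolding A'_def by (intro continuous_intros cc cG cGp) (use P0 in auto)
  have cB': "continuous_on X B'" for X unfolding B'_def by (intro continuous_intros cc cF)
  have cC': "continuous_on X C'" for X unfolding C'_def by (intro continuous_intros cc cF) (use P0 in auto)
  have c\<alpha>: "continuous_on X \<alpha>" for X unfolding \<alpha>_def by (intro continuous_intros cc cA) (use P0 \<kappa> in auto)
  have c\<beta>: "continuous_on X \<beta>" for X unfolding \<beta>_def by (intro continuous_intros cc cB) (use P0 \<kappa> in auto)
  have c\<rho>: "continuous_on X \<rho>" for X unfolding \<rho>_def by (intro continuous_intros cc cF cG cB) (use P0 \<kappa> in auto)
  \<comment> \<open>\<open>\<kappa> - B\<close> contains the factor \<open>\<psi> - m\<close>, as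
    does the square of \<open>U1\<close>; this cancellation is what leaves \<open>G\<close> with the
    nonvanishing denominator \<open>\<psi> + m\<close>.\<close>
  have K: "\<kappa> = B z + (U1 z)\<^sup>2 * G z" for z
  proof -
    have UG: "(U1 z)\<^sup>2 * G z = (2 * \<theta> - 1 + \<theta>\<^sup>2 * (U z)\<^sup>2) * (\<psi> z - m)"
    proof -
      have "(\<psi> z)\<^sup>2 - m\<^sup>2 = (\<psi> z - m) * (\<psi> z + m)" by (simp add: power2_eq_square algebra_simps)
      then show ?thesis unfolding U1_sq G_def using \<psi>_pos[of z] sp[of z] by simp
    qed
    have e2: "2 * (\<gamma> - m) = 2 * (\<psi> z - m) + (U z)\<^sup>2" by (simp add: \<psi>_def)
    show ?thesis unfolding UG \<kappa>_def e2 B_def F_def by (simp add: algebra_simps)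
  qed
  have E5: "1 - (U1 z)\<^sup>2 = \<psi> z / P z" for z
    using energy[of z] \<psi>_pos[of z] m_pos by (simp add: P_def field_simps power2_eq_square power3_eq_cube)
  have E4: "2 * F z - 1 + \<theta>\<^sup>2 * (U z)\<^sup>2 = 2 * G z / P z + (U1 z)\<^sup>2 * Gp z" for z
    unfolding F_def G_def Gp_def P_def
    by (rule multiplier_derivative_identity[OF \<psi>_pos m_pos U1_sq refl])
  have id: "w\<^sup>2 - (\<psi> z + \<kappa>) * v\<^sup>2 + \<kappa> * P z * d\<^sup>2
      + (A' z * v\<^sup>2 + A z * (2 * v * d) + 2 * (B' z * (w * v) + B z * (v * v + w * d)) + (C' z * w\<^sup>2 + C z * (2 * w * v)))
    = \<kappa> * P z * (d + \<alpha> z * v + \<beta> z * w)\<^sup>2 + \<rho> z * (U z * v - U1 z * w)\<^sup>2" for w v d z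
    unfolding \<alpha>_def \<beta>_def
    by (rule density_identity[OF _ _ _ K E4 E5])
      (use \<kappa> P0 in \<open>simp_all add: B_def \<rho>_def A_def C_def A'_def B'_def C'_def\<close>)
  \<comment> \<open>\<open>K\<close> shows that the profile \<open>U\<close> annihilates the first
    square, which supplies the linear equation required by
    \<open>coercive_from_wronskian\<close>.\<close>
  have dU1': "(U1 has_real_derivative - \<alpha> z * U1 z - \<beta> z * U z) (at z)" for z
  proof -
    have "\<alpha> z * U1 z + \<beta> z * U z = U z * (B z + (U1 z)\<^sup>2 * G z) / (\<kappa> * P z)"
      by (simp add: \<alpha>_def \<beta>_def A_def add_divide_distrib[symmetric] power2_eq_square algebra_simps)
    also have "\<dots> = U z / P z" using \<kappa> unfolding K[symmetric] by simp
    finally have "- \<alpha> z * U1 z - \<beta> z * U z = - U z / P z" by simp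
    then show ?thesis using dU1 by simp
  qed
  obtain M where M: "M > 0"
    "\<And>w v d. ac_deriv T w v \<Longrightarrow> ac_deriv T v d \<Longrightarrow> set_integrable lborel {0..T} (\<lambda>x. (d x)\<^sup>2) \<Longrightarrow>
      (LBINT x:{0..T}. U1 x * v x) = 0 \<Longrightarrow>
      (LBINT x:{0..T}. (v x)\<^sup>2 + (d x)\<^sup>2)
        \<le> M * (LBINT x:{0..T}. (d x + \<alpha> x * v x + \<beta> x * w x)\<^sup>2 + (U x * v x - U1 x * w x)\<^sup>2)"
  proof (rule coercive_from_wronskian[OF T0 dU dU1' c\<alpha> c\<beta> U_nontrivial U1_integral_pos[OF T0]], goal_cases)
    case (1 M) from this(1)[OF this(2,3)] show ?case .
  qed
  \<comment> \<open>Positive continuous functions on a compact interval are bounded below, so both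
    squares can be given one common weight \<open>k\<close>.\<close>
  obtain k1 where k1: "k1 > 0" "\<And>x. x \<in> {0..T} \<Longrightarrow> k1 \<le> \<kappa> * P x"
    by (rule continuous_on_Icc_pos_lower_bound[of 0 T "\<lambda>x. \<kappa> * P x"])
      (use T0 \<kappa> P_pos in \<open>auto intro!: continuous_intros cont_P\<close>)
  obtain k2 where k2: "k2 > 0" "\<And>x. x \<in> {0..T} \<Longrightarrow> k2 \<le> \<rho> x"
    by (rule continuous_on_Icc_pos_lower_bound[OF c\<rho>, of 0 T]) (use T0 \<rho> in auto)
  define k where "k = min k1 k2"
  have k: "k > 0" "\<And>x. x \<in> {0..T} \<Longrightarrow> k \<le> \<kappa> * P x" "\<And>x. x \<in> {0..T} \<Longrightarrow> k \<le> \<rho> x"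
    using k1 k2 by (auto simp: k_def min_le_iff_disj)
  have perT: "U T = U 0" "U1 T = U1 0"
    unfolding T(1) by (intro periodic_multiple per_U per_U1)+
  then have perT': "A T = A 0" "B T = B 0" "C T = C 0"
    by (simp_all add: A_def B_def C_def G_def F_def \<psi>_def)
  show ?thesis
  proof (rule that[of "k / M"])
    show "k / M > 0" using k M by simp
    fix v assume v: "v \<in> H1_per_zero T" and orth: "L2_inner T (deriv U) v = 0"
    define d where "d = weak_deriv T v"
    define w where "w = zero_mean_antideriv T v"
    obtain V where V: "has_weak_deriv T v d" "ac_deriv T V d" "V 0 = V T"
      "AE x in lborel. x \<in> {0..T} \<longrightarrow> v x = V x" "ac_deriv T w V" "w 0 = w T"
      by (rule H1_per_zeroE[OF v T0, folded d_def w_def])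
    have cw: "continuous_on {0..T} w" and cV: "continuous_on {0..T} V"
      using V(2,5) ac_deriv_continuous by blast+
    have L2: "v \<in> L2_per T" "d \<in> L2_per T" using V(1) by (auto simp: has_weak_deriv_def)
    then have iv2: "set_integrable lborel {0..T} (\<lambda>x. (v x)\<^sup>2)" and id2: "set_integrable lborel {0..T} (\<lambda>x. (d x)\<^sup>2)"
      by (auto simp: L2_per_def)
    have iv: "set_integrable lborel {0..T} v" and id1: "set_integrable lborel {0..T} d"
      using L2 by (auto intro: L2_per_integrable)
    have iV2: "set_integrable lborel {0..T} (\<lambda>x. (V x)\<^sup>2)"
      by (intro set_integrable_continuous_Icc continuous_intros cV)
    have orthV: "(LBINT x:{0..T}. U1 x * V x) = 0"
    proof -
      have "(LBINT x:{0..T}. U1 x * V x) = (LBINT x:{0..T}. U1 x * v x)"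
      proof (rule set_integral_cong_AE_integrable)
        show "AE x in lborel. x \<in> {0..T} \<longrightarrow> U1 x * V x = U1 x * v x" using V(4) by eventually_elim auto
      qed (intro set_integrable_continuous_mult cont_U1 iv set_integrable_continuous_Icc cV)+
      then show ?thesis using orth by (simp add: L2_inner_def U1_def)
    qed
    define g1 where "g1 = (\<lambda>x. d x + \<alpha> x * V x + \<beta> x * w x)"
    define g2 where "g2 = (\<lambda>x. U x * V x - U1 x * w x)"
    define W' where "W' = (\<lambda>x. A' x * (V x)\<^sup>2 + A x * (2 * V x * d x) + 2 * (B' x * (w x * V x) + B x * (V x * V x + w x * d x))
       + (C' x * (w x)\<^sup>2 + C x * (2 * w x * V x)))"
    define Q where "Q = (\<lambda>x. (w x)\<^sup>2 - (\<psi> x + \<kappa>) * (V x)\<^sup>2 + \<kappa> * P x * (d x)\<^sup>2)"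
    have aA: "ac_deriv T A A'" by (rule ac_deriv_C1[OF dA cA'])
    have aB: "ac_deriv T B B'" by (rule ac_deriv_C1[OF dB cB'])
    have aC: "ac_deriv T C C'" by (rule ac_deriv_C1[OF dC cC'])
    have "ac_deriv T (\<lambda>x. A x * (V x * V x) + 2 * (B x * (w x * V x)) + C x * (w x * w x))
       (\<lambda>x. (A' x * (V x * V x) + A x * (d x * V x + V x * d x)) + 2 * (B' x * (w x * V x) + B x * (V x * V x + w x * d x))
         + (C' x * (w x * w x) + C x * (V x * w x + w x * V x)))"
      by (intro ac_deriv_add ac_deriv_mult ac_deriv_cmult aA aB aC V)
    also have "(\<lambda>x. (A' x * (V x * V x) + A x * (d x * V x + V x * d x)) + 2 * (B' x * (w x * V x) + B x * (V x * V x + w x * d x))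
         + (C' x * (w x * w x) + C x * (V x * w x + w x * V x))) = W'"
      by (simp add: W'_def fun_eq_iff power2_eq_square algebra_simps)
    finally have aW: "ac_deriv T (\<lambda>x. A x * (V x * V x) + 2 * (B x * (w x * V x)) + C x * (w x * w x)) W'" .
    have iW: "set_integrable lborel {0..T} W'" by (rule ac_deriv_integrable[OF aW])
    \<comment> \<open>\<open>W'\<close> is the derivative of an expression with equal values at
      \<open>0\<close> and \<open>T\<close>, so adding it to the density leaves the integral
      unchanged.\<close>
    have W0: "(LBINT x:{0..T}. W' x) = 0"
      using aW T0 perT' V(3,6) by (simp add: ac_deriv_def)
    have iQ: "set_integrable lborel {0..T} Q" unfolding Q_def
      by (intro set_integral_add set_integral_diff set_integrable_continuous_mult iV2 id2 set_integrable_continuous_Icc continuous_intros cw cc)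
    have ig1: "set_integrable lborel {0..T} (\<lambda>x. (g1 x)\<^sup>2)"
    proof -
      have "set_integrable lborel {0..T} (\<lambda>x. (1 * d x + (\<alpha> x * V x + \<beta> x * w x))\<^sup>2)"
        by (rule set_integrable_square_affine[OF _ _ id1 id2]) (intro continuous_intros c\<alpha> c\<beta> cw cV)+
      then show ?thesis by (simp add: g1_def add.assoc)
    qed
    have ig2: "set_integrable lborel {0..T} (\<lambda>x. (g2 x)\<^sup>2)" unfolding g2_def
      by (intro set_integrable_continuous_Icc continuous_intros cc cw cV)
    have eq: "delta2_Lambda T (2 * m * \<kappa>) \<gamma> I U v = (LBINT x:{0..T}. Q x)"
    proof -
      have v1: "has_weak_deriv T v (weak_deriv T v)" using V(1) by (simp add: d_def)
      have w1: "continuous_on {0..T} (zero_mean_antideriv T v)" using cw by (simp add: w_def)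
      note da = delta2_affine[OF v1 w1, folded d_def w_def]
      have "delta2_Lambda T (2 * m * \<kappa>) \<gamma> I U v = 
        (LBINT x:{0..T}. (w x)\<^sup>2 - \<psi> x * (v x)\<^sup>2) + \<kappa> * (LBINT x:{0..T}. P x * (d x)\<^sup>2 - (v x)\<^sup>2)"
        using da(3)[of "2 * m * \<kappa>"] m_pos by simp
      also have "\<dots> = (LBINT x:{0..T}. ((w x)\<^sup>2 - \<psi> x * (v x)\<^sup>2) + \<kappa> * (P x * (d x)\<^sup>2 - (v x)\<^sup>2))"
        using da(1,2) by simp
      also have "\<dots> = (LBINT x:{0..T}. Q x)"
      proof (rule set_integral_cong_AE_integrable[OF _ iQ])
        show "set_integrable lborel {0..T} (\<lambda>x. ((w x)\<^sup>2 - \<psi> x * (v x)\<^sup>2) + \<kappa> * (P x * (d x)\<^sup>2 - (v x)\<^sup>2))"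
          using da(1,2) by simp
        show "AE x in lborel. x \<in> {0..T} \<longrightarrow> ((w x)\<^sup>2 - \<psi> x * (v x)\<^sup>2) + \<kappa> * (P x * (d x)\<^sup>2 - (v x)\<^sup>2) = Q x"
          using V(4) by eventually_elim (auto simp: Q_def algebra_simps)
      qed
      finally show ?thesis .
    qed
    have H1: "(H1_norm T v)\<^sup>2 = (LBINT x:{0..T}. (V x)\<^sup>2 + (d x)\<^sup>2)"
    proof -
      have "0 \<le> (LBINT x:{0..T}. (v x)\<^sup>2 + (d x)\<^sup>2)"
        unfolding set_lebesgue_integral_def by (rule integral_nonneg_AE) auto
      then have "(H1_norm T v)\<^sup>2 = (LBINT x:{0..T}. (v x)\<^sup>2 + (d x)\<^sup>2)"
        by (simp add: H1_norm_def d_def)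
      also have "\<dots> = (LBINT x:{0..T}. (V x)\<^sup>2 + (d x)\<^sup>2)"
      proof (rule set_integral_cong_AE_integrable)
        show "AE x in lborel. x \<in> {0..T} \<longrightarrow> (v x)\<^sup>2 + (d x)\<^sup>2 = (V x)\<^sup>2 + (d x)\<^sup>2"
          using V(4) by eventually_elim auto
      qed (use iv2 iV2 id2 in simp_all)
      finally show ?thesis .
    qed
    have "k / M * (H1_norm T v)\<^sup>2 \<le> k / M * (M * (LBINT x:{0..T}. (g1 x)\<^sup>2 + (g2 x)\<^sup>2))"
      unfolding H1 g1_def g2_def
      by (rule mult_left_mono[OF M(2)[OF V(5,2) id2 orthV]]) (use k M in simp)
    also have "\<dots> = (LBINT x:{0..T}. k * ((g1 x)\<^sup>2 + (g2 x)\<^sup>2))" using M(1) by simp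
    also have "\<dots> \<le> (LBINT x:{0..T}. Q x + W' x)"
    proof (rule set_integral_mono)
      show "set_integrable lborel {0..T} (\<lambda>x. k * ((g1 x)\<^sup>2 + (g2 x)\<^sup>2))" using ig1 ig2 by simp
      show "set_integrable lborel {0..T} (\<lambda>x. Q x + W' x)" using iQ iW by simp
      fix x assume x: "x \<in> {0..T}"
      have "k * ((g1 x)\<^sup>2 + (g2 x)\<^sup>2) \<le> \<kappa> * P x * (g1 x)\<^sup>2 + \<rho> x * (g2 x)\<^sup>2"
        unfolding distrib_left by (intro add_mono mult_right_mono k x) auto
      also have "\<dots> = Q x + W' x"
        unfolding Q_def W'_def g1_def g2_def by (rule id[symmetric])
      finally show "k * ((g1 x)\<^sup>2 + (g2 x)\<^sup>2) \<le> Q x + W' x" .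
    qed
    also have "\<dots> = (LBINT x:{0..T}. Q x)" using iQ iW W0 by simp
    finally show "k / M * (H1_norm T v)\<^sup>2 \<le> delta2_Lambda T (2 * m * \<kappa>) \<gamma> I U v" by (simp add: eq)
  qed
qed

text \<open>The choice \<open>\<theta> = t / e\<close> turns \<open>\<kappa>\<close> into
  \<open>m + t * e\<close>. Since the square of \<open>U\<close> is
  \<open>e\<^sup>2 - 2 * (\<psi> - m)\<close>, \<open>weight_pos\<close> applies pointwise with
  \<open>x = \<psi> z - m\<close>.\<close>

lemma delta2_coercive_near_resonance:
  fixes t :: real
  defines "e \<equiv> sqrt (2 * (\<gamma> - m))"
  assumes e: "e \<le> 1/24" "\<bar>m - 1\<bar> \<le> e" and t: "\<bar>t\<bar> \<le> 1 - 24 * e" and T: "T = 2 * pi * real N" "N \<ge> 1"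
  obtains C where "C > 0"
    "\<And>v. v \<in> H1_per_zero T \<Longrightarrow> L2_inner T (deriv U) v = 0 \<Longrightarrow>
       C * (H1_norm T v)\<^sup>2 \<le> delta2_Lambda T (2 * m * (m + t * e)) \<gamma> I U v"
proof -
  define \<theta> where "\<theta> = t / e"
  have e0: "e > 0" and e2: "e\<^sup>2 = 2 * (\<gamma> - m)" using m_lt by (simp_all add: e_def)
  have \<kappa>: "m + \<theta> * (2 * (\<gamma> - m)) = m + t * e"
    unfolding e2[symmetric] \<theta>_def using e0 by (simp add: power2_eq_square)
  have t1: "\<bar>t\<bar> \<le> 1" using t e0 by linarith
  have "\<bar>t * e\<bar> \<le> 1 * (1/24)" by (rule abs_mult_le) (use t1 e e0 in auto)
  then have k0: "m + \<theta> * (2 * (\<gamma> - m)) > 0" unfolding \<kappa> using e by linarith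
  have \<rho>: "0 < 1 - (\<theta> - \<theta>\<^sup>2 * (\<psi> z - m)) - \<theta>\<^sup>2 * (U z)\<^sup>2 +
      (2 * \<theta> - 1 + \<theta>\<^sup>2 * (U z)\<^sup>2) * (\<psi> z)\<^sup>2 / (\<psi> z + m) * (\<psi> z + (U z)\<^sup>2 * (\<theta> - \<theta>\<^sup>2 * (\<psi> z - m))) /
      ((m + \<theta> * (2 * (\<gamma> - m))) * P z)" for z
  proof -
    have x: "0 \<le> \<psi> z - m" "2 * (\<psi> z - m) \<le> e\<^sup>2" using m_le_\<psi>[of z] by (auto simp: e2 \<psi>_def)
    have u: "e\<^sup>2 - 2 * (\<psi> z - m) = (U z)\<^sup>2" by (simp add: e2 \<psi>_def)
    show ?thesis
      using weight_pos[OF e0 e x t] unfolding u \<theta>_def[symmetric] e2[symmetric] P_def by simp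
  qed
  show ?thesis
    by (rule form_ge_wronskian_form[OF k0 \<rho> T, unfolded \<kappa>]) (rule that)
qed

text \<open>For fixed \<open>v\<close> the form is affine in \<open>c\<close>; the sign of its slope
  decides which endpoint supplies the lower bound.\<close>

lemma delta2_affine_bound:
  assumes T: "T > 0" and v: "v \<in> H1_per_zero T" and c: "c1 < c" "c < c2"
    and lo: "C \<le> delta2_Lambda T c1 \<gamma> I U v" "C \<le> delta2_Lambda T c2 \<gamma> I U v"
  shows "C \<le> delta2_Lambda T c \<gamma> I U v"
proof -
  obtain V where "has_weak_deriv T v (weak_deriv T v)" "ac_deriv T (zero_mean_antideriv T v) V"
    by (rule H1_per_zeroE[OF v T])
  then obtain X Y where XY: "\<And>c. delta2_Lambda T c \<gamma> I U v = X + c / (2 * m) * Y"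
    using delta2_affine(3) ac_deriv_continuous by blast
  show ?thesis
  proof (cases "Y \<ge> 0")
    case True
    have "c1 / (2 * m) * Y \<le> c / (2 * m) * Y"
      using True c m_pos by (intro mult_right_mono divide_right_mono) auto
    then show ?thesis using lo(1) by (simp add: XY)
  next
    case False
    have "c2 / (2 * m) * Y \<le> c / (2 * m) * Y"
      using False c m_pos by (intro mult_right_mono_neg divide_right_mono) auto
    then show ?thesis using lo(2) by (simp add: XY)
  qed
qed

text \<open>The endpoints correspond to the extreme parameters \<open>t = 1 - 24 * e\<close> and its
  negative. The smaller of the two endpoint constants works for every \<open>c\<close> in
  between.\<close>

lemma delta2_coercive:
  defines "e \<equiv> sqrt (2 * (\<gamma> - m))"
  assumes e: "e \<le> 1/24" "\<bar>m - 1\<bar> \<le> e" and N: "N \<ge> 1"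
  shows "\<exists>C>0. \<forall>c\<in>{2 * m * (m - e * (1 - 24 * e))<..<2 * m * (m + e * (1 - 24 * e))}.
     \<forall>v\<in>H1_per_zero (2 * pi * real N). L2_inner (2 * pi * real N) (deriv U) v = 0 \<longrightarrow>
       C * (H1_norm (2 * pi * real N) v)\<^sup>2 \<le> delta2_Lambda (2 * pi * real N) c \<gamma> I U v"
proof -
  define T where "T = 2 * pi * real N"
  have T: "T > 0" using N by (simp add: T_def)
  define t where "t = 1 - 24 * e"
  have t: "\<bar>t\<bar> \<le> 1 - 24 * e" "\<bar>- t\<bar> \<le> 1 - 24 * e" using e by (auto simp: t_def)
  note near = delta2_coercive_near_resonance[folded e_def, OF e _ T_def N]
  obtain C1 where C1: "C1 > 0" "\<And>v. v \<in> H1_per_zero T \<Longrightarrow> L2_inner T (deriv U) v = 0 \<Longrightarrow>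
       C1 * (H1_norm T v)\<^sup>2 \<le> delta2_Lambda T (2 * m * (m + t * e)) \<gamma> I U v"
    by (rule near[OF t(1)]) (rule that)
  obtain C2 where C2: "C2 > 0" "\<And>v. v \<in> H1_per_zero T \<Longrightarrow> L2_inner T (deriv U) v = 0 \<Longrightarrow>
       C2 * (H1_norm T v)\<^sup>2 \<le> delta2_Lambda T (2 * m * (m + - t * e)) \<gamma> I U v"
    by (rule near[OF t(2)]) (rule that)
  have eq: "m + t * e = m + e * (1 - 24 * e)" "m + - t * e = m - e * (1 - 24 * e)"
    by (simp_all add: t_def algebra_simps)
  have "min C1 C2 * (H1_norm T v)\<^sup>2 \<le> delta2_Lambda T c \<gamma> I U v"
    if c: "2 * m * (m + - t * e) < c" "c < 2 * m * (m + t * e)" and v: "v \<in> H1_per_zero T" "L2_inner T (deriv U) v = 0" for c v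
  proof (rule delta2_affine_bound[OF T v(1) c])
    have "min C1 C2 * (H1_norm T v)\<^sup>2 \<le> C2 * (H1_norm T v)\<^sup>2" by (intro mult_right_mono) auto
    also note C2(2)[OF v]
    finally show "min C1 C2 * (H1_norm T v)\<^sup>2 \<le> delta2_Lambda T (2 * m * (m + - t * e)) \<gamma> I U v" .
    have "min C1 C2 * (H1_norm T v)\<^sup>2 \<le> C1 * (H1_norm T v)\<^sup>2" by (intro mult_right_mono) auto
    also note C1(2)[OF v]
    finally show "min C1 C2 * (H1_norm T v)\<^sup>2 \<le> delta2_Lambda T (2 * m * (m + t * e)) \<gamma> I U v" .
  qed
  then show ?thesis
    using C1(1) C2(1) unfolding eq T_def by (intro exI[of _ "min C1 C2"]) simp
qed

end

section \<open>Small amplitudes\<close>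

text \<open>Explicit error bounds: \<open>m - 1\<close> is of order \<open>a\<close> squared and
  \<open>e - a\<close> of order \<open>a\<close> cubed. The threshold \<open>1 / (100 * K)\<close>
  makes \<open>K * a\<close> at most 1/100, which keeps every remainder small against
  \<open>a\<close>.\<close>

lemma small_amplitude_parameters:
  fixes a K \<gamma> I :: real
  defines "m \<equiv> sqrt (\<gamma>\<^sup>2 - 2 * I)" 
  defines "e \<equiv> sqrt (2 * (\<gamma> - m))"
  assumes K: "K \<ge> 1" and a: "0 < a" "a \<le> 1 / (100 * K)"
    and \<gamma>: "\<bar>\<gamma> - 1\<bar> \<le> K * a\<^sup>2" and I: "\<bar>I - a\<^sup>2 / 2\<bar> \<le> K * a ^ 4 / 2"
  shows "I > 0" "\<gamma> > 0" "0 < m" "m < \<gamma>" "0 < e" "e \<le> 1/24" "\<bar>m - 1\<bar> \<le> e"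
    "\<bar>2 * m * (m + e * (1 - 24 * e)) - (2 + 2 * a)\<bar> \<le> 500 * K * a\<^sup>2"
    "\<bar>2 * m * (m - e * (1 - 24 * e)) - (2 - 2 * a)\<bar> \<le> 500 * K * a\<^sup>2"
proof -
  have Ka: "K * a \<le> 1/100" using a K by (simp add: field_simps)
  have "1 * a \<le> K * a" using K a by (intro mult_right_mono) auto
  then have a1: "a \<le> 1/100" using Ka by linarith
  have Ka2: "K * a\<^sup>2 \<le> a / 100" using mult_right_mono[OF Ka, of a] a by (simp add: power2_eq_square)
  have a2K: "a\<^sup>2 \<le> K * a\<^sup>2" using mult_right_mono[OF K, of "a\<^sup>2"] by simp
  have Ka4: "K * a ^ 4 \<le> a\<^sup>2 * (1 / 10000)"
  proof -
    have "K * a ^ 4 = a\<^sup>2 * (K * a\<^sup>2)" by (simp add: power2_eq_square power4_eq_xxxx)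
    also have "\<dots> \<le> a\<^sup>2 * (1 / 10000)" using Ka2 a1 by (intro mult_left_mono) auto
    finally show ?thesis .
  qed
  have a2: "a\<^sup>2 > 0" using a by simp
  show I0: "I > 0" using I Ka4 a2 by linarith
  have \<gamma>b: "99/100 \<le> \<gamma>" "\<gamma> \<le> 101/100" using \<gamma> Ka2 a1 by (auto simp: abs_le_iff)
  then show \<gamma>0: "\<gamma> > 0" by simp
  have I2: "2 * I \<le> 2 * a\<^sup>2" "2 * I \<ge> 0" using I Ka4 a2 I0 by linarith+
  have g2: "\<bar>\<gamma>\<^sup>2 - 1\<bar> \<le> 3 * (K * a\<^sup>2)"
  proof -
    have "\<bar>\<gamma>\<^sup>2 - 1\<bar> = \<bar>\<gamma> - 1\<bar> * \<bar>\<gamma> + 1\<bar>" by (simp add: abs_mult[symmetric] power2_eq_square algebra_simps)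
    also have "\<dots> \<le> (K * a\<^sup>2) * 3" using \<gamma>b \<gamma> by (intro mult_mono) auto
    finally show ?thesis by simp
  qed
  have m2': "\<bar>\<gamma>\<^sup>2 - 2 * I - 1\<bar> \<le> 5 * (K * a\<^sup>2)" using g2 I2 a2K by linarith
  have pos: "\<gamma>\<^sup>2 - 2 * I > 0" using m2' Ka2 a1 by linarith
  then show m0: "0 < m" by (simp add: m_def)
  have m2: "m\<^sup>2 = \<gamma>\<^sup>2 - 2 * I" using pos by (simp add: m_def)
  show m\<gamma>: "m < \<gamma>" using m2 I0 \<gamma>0 by (intro power_less_imp_less_base[of m 2 \<gamma>]) auto
  have m1: "\<bar>m - 1\<bar> \<le> 5 * (K * a\<^sup>2)"
  proof -
    have "\<bar>m - 1\<bar> * 1 \<le> \<bar>m - 1\<bar> * \<bar>m + 1\<bar>" using m0 by (intro mult_left_mono) auto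
    also have "\<dots> = \<bar>m\<^sup>2 - 1\<bar>" by (simp add: abs_mult[symmetric] power2_eq_square algebra_simps)
    finally show ?thesis using m2' m2 by simp
  qed
  have e2: "e\<^sup>2 = 2 * (\<gamma> - m)" using m\<gamma> by (simp add: e_def)
  show e0: "0 < e" using m\<gamma> by (simp add: e_def)
  have gm: "\<bar>\<gamma> + m - 2\<bar> \<le> 6 * (K * a\<^sup>2)" using \<gamma> m1 by linarith
  have gm1: "\<gamma> + m \<ge> 1" using gm Ka2 a1 by linarith
  have ea2: "\<bar>e\<^sup>2 - a\<^sup>2\<bar> \<le> 8 * (K * a\<^sup>2) * a\<^sup>2"
  proof -
    \<comment> \<open>Multiplying by \<open>\<gamma> + m\<close> removes the square root in
      \<open>m\<close>, since \<open>e\<^sup>2 * (\<gamma> + m) = 4 * I\<close>.\<close>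
    have "(e\<^sup>2 - a\<^sup>2) * (\<gamma> + m) = 4 * (I - a\<^sup>2 / 2) - a\<^sup>2 * (\<gamma> + m - 2)"
    proof -
      have "e\<^sup>2 * (\<gamma> + m) = 2 * (\<gamma>\<^sup>2 - m\<^sup>2)" unfolding e2 by (simp add: power2_eq_square algebra_simps)
      also have "\<dots> = 4 * I" by (simp add: m2)
      finally show ?thesis by (simp add: algebra_simps)
    qed
    then have "\<bar>e\<^sup>2 - a\<^sup>2\<bar> * \<bar>\<gamma> + m\<bar> = \<bar>4 * (I - a\<^sup>2 / 2) - a\<^sup>2 * (\<gamma> + m - 2)\<bar>"
      by (simp add: abs_mult[symmetric])
    also have "\<dots> \<le> \<bar>4 * (I - a\<^sup>2 / 2)\<bar> + \<bar>a\<^sup>2 * (\<gamma> + m - 2)\<bar>" by (rule abs_triangle_ineq4)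
    also have "\<bar>4 * (I - a\<^sup>2 / 2)\<bar> = 4 * \<bar>I - a\<^sup>2 / 2\<bar>" by (subst abs_mult) simp
    also have "\<bar>a\<^sup>2 * (\<gamma> + m - 2)\<bar> = a\<^sup>2 * \<bar>\<gamma> + m - 2\<bar>" by (simp add: abs_mult)
    also have "4 * \<bar>I - a\<^sup>2 / 2\<bar> + a\<^sup>2 * \<bar>\<gamma> + m - 2\<bar> \<le> 4 * (K * a ^ 4 / 2) + a\<^sup>2 * (6 * (K * a\<^sup>2))"
      by (intro add_mono mult_left_mono I gm) auto
    also have "\<dots> = 8 * (K * a\<^sup>2) * a\<^sup>2" by (simp add: power2_eq_square power4_eq_xxxx)
    finally have "\<bar>e\<^sup>2 - a\<^sup>2\<bar> * \<bar>\<gamma> + m\<bar> \<le> 8 * (K * a\<^sup>2) * a\<^sup>2" .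
    moreover have "\<bar>e\<^sup>2 - a\<^sup>2\<bar> * 1 \<le> \<bar>e\<^sup>2 - a\<^sup>2\<bar> * \<bar>\<gamma> + m\<bar>" using gm1 by (intro mult_left_mono) auto
    ultimately show ?thesis by simp
  qed
  have ea: "\<bar>e - a\<bar> \<le> 8 * (K * a\<^sup>2) * a"
  proof -
    have "\<bar>e - a\<bar> * a \<le> \<bar>e - a\<bar> * \<bar>e + a\<bar>" using e0 a by (intro mult_left_mono) auto
    also have "\<dots> = \<bar>e\<^sup>2 - a\<^sup>2\<bar>" by (simp add: abs_mult[symmetric] power2_eq_square algebra_simps)
    also have "\<dots> \<le> (8 * (K * a\<^sup>2) * a) * a" using ea2 by (simp add: power2_eq_square)
    finally show ?thesis using a by simp
  qed
  have "8 * (K * a\<^sup>2) * a \<le> (8 * (1 / 10000)) * a" using Ka2 a1 a by (intro mult_right_mono) auto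
  with ea have "\<bar>e - a\<bar> \<le> (8 * (1 / 10000)) * a" by (rule order_trans)
  then have eb: "a / 2 \<le> e" "e \<le> 3 / 2 * a" using a by linarith+
  then show "e \<le> 1/24" using a1 by linarith
  show "\<bar>m - 1\<bar> \<le> e" using m1 Ka2 eb a by linarith
  have mea: "\<bar>m * e - a\<bar> \<le> 13 * (K * a\<^sup>2)"
  proof -
    have "m * e - a = (m - 1) * e + (e - a)" by (simp add: algebra_simps)
    moreover have "\<bar>(m - 1) * e\<bar> \<le> (5 * (K * a\<^sup>2)) * 1" by (rule abs_mult_le[OF m1]) (use eb a1 a in auto)
    moreover have "8 * (K * a\<^sup>2) * a \<le> 8 * (K * a\<^sup>2) * 1" using a1 K by (intro mult_left_mono) auto
    ultimately show ?thesis using ea by linarith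
  qed
  have mee: "0 \<le> m * e\<^sup>2" "m * e\<^sup>2 \<le> 4 * (K * a\<^sup>2)"
  proof -
    show "0 \<le> m * e\<^sup>2" using m0 by simp
    have "e\<^sup>2 \<le> (3 / 2 * a)\<^sup>2" using eb e0 by (intro power_mono) auto
    then have "m * e\<^sup>2 \<le> (3/2) * (3 / 2 * a)\<^sup>2" using m\<gamma> m0 \<gamma>b by (intro mult_mono) auto
    also have "\<dots> \<le> 4 * a\<^sup>2" by (simp add: power_mult_distrib power2_eq_square)
    finally show "m * e\<^sup>2 \<le> 4 * (K * a\<^sup>2)" using a2K by linarith
  qed
  have m21: "\<bar>m\<^sup>2 - 1\<bar> \<le> 5 * (K * a\<^sup>2)" using m2' m2 by simp
  have p: "2 * m * (m + e * (1 - 24 * e)) - (2 + 2 * a) = 2 * (m\<^sup>2 - 1) + 2 * (m * e - a) - 48 * (m * e\<^sup>2)"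
    by (simp add: algebra_simps power2_eq_square)
  have q: "2 * m * (m - e * (1 - 24 * e)) - (2 - 2 * a) = 2 * (m\<^sup>2 - 1) - 2 * (m * e - a) + 48 * (m * e\<^sup>2)"
    by (simp add: algebra_simps power2_eq_square)
  \<comment> \<open>With \<open>k = K * a\<^sup>2\<close> the three terms contribute at most 10, 26
    and 192 times \<open>k\<close>, well within 500.\<close>
  have comb: "\<bar>2 * x + 2 * y - 48 * z\<bar> \<le> 500 * k \<and> \<bar>2 * x - 2 * y + 48 * z\<bar> \<le> 500 * k"
    if "\<bar>x\<bar> \<le> 5 * k" "\<bar>y\<bar> \<le> 13 * k" "0 \<le> z" "z \<le> 4 * k" for x y z k :: real
    using that by (simp add: abs_le_iff)
  from comb[OF m21 mea mee]
  show "\<bar>2 * m * (m + e * (1 - 24 * e)) - (2 + 2 * a)\<bar> \<le> 500 * K * a\<^sup>2"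
    "\<bar>2 * m * (m - e * (1 - 24 * e)) - (2 - 2 * a)\<bar> \<le> 500 * K * a\<^sup>2"
    unfolding p q mult.assoc[of 500 K] by blast+
qed

lemma eventually_at_right_0:
  fixes Q :: "real \<Rightarrow> bool"
  assumes "eventually Q (at_right 0)"
  obtains b where "b > 0" "\<And>a. 0 < a \<Longrightarrow> a < b \<Longrightarrow> Q a"
  using assms unfolding eventually_at_right_field by blast

theorem theorem3p8:
  fixes a0 :: real and \<gamma> I :: "real \<Rightarrow> real" and U :: "real \<Rightarrow> real \<Rightarrow> real"
  assumes waves: "small_amplitude_waves a0 \<gamma> I U"
  shows "\<exists>\<gamma>0 c_minus c_plus.
     1 < \<gamma>0 \<and> \<gamma>0 < pi\<^sup>2 / 8 \<and>
     (\<lambda>a. c_minus a - (2 - 2 * a)) \<in> O[at_right 0](\<lambda>a::real. a\<^sup>2) \<and>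
     (\<lambda>a. c_plus a - (2 + 2 * a)) \<in> O[at_right 0](\<lambda>a::real. a\<^sup>2) \<and>
     (\<forall>g\<in>{1<..<\<gamma>0}. \<exists>a\<in>{0<..<a0}. \<gamma> a = g \<and>
       (\<forall>N::nat. N \<ge> 1 \<longrightarrow>
         (\<exists>C>0. \<forall>c\<in>{c_minus a<..<c_plus a}. \<forall>v\<in>H1_per_zero (2 * pi * real N).
            L2_inner (2 * pi * real N) (deriv (U a)) v = 0 \<longrightarrow>
            delta2_Lambda (2 * pi * real N) c (\<gamma> a) (I a) (U a) v
              \<ge> C * (H1_norm (2 * pi * real N) v)\<^sup>2)))"
proof -
  have a0: "a0 > 0" and mono: "strict_mono_on {0<..<a0} \<gamma>"
    and wave: "\<And>a. a \<in> {0<..<a0} \<Longrightarrow> periodic_wave (\<gamma> a) (I a) (U a)"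
    and g: "(\<lambda>a. \<gamma> a - (1 + a\<^sup>2 / 8)) \<in> O[at_right 0](\<lambda>a. a ^ 4)"
    and i: "(\<lambda>a. I a - a\<^sup>2 / 2) \<in> O[at_right 0](\<lambda>a. a ^ 4)"
    using waves by (auto simp: small_amplitude_waves_def)
  obtain \<gamma>1 where \<gamma>1: "\<gamma> ` {0<..<a0} = {1<..<\<gamma>1}" using waves by (auto simp: small_amplitude_waves_def)
  obtain Kg where Kg: "Kg > 0" "eventually (\<lambda>a. norm (\<gamma> a - (1 + a\<^sup>2 / 8)) \<le> Kg * norm (a ^ 4)) (at_right 0)"
    using g by (rule landau_o.bigE)
  obtain bg where bg: "bg > 0" "\<And>a. 0 < a \<Longrightarrow> a < bg \<Longrightarrow> norm (\<gamma> a - (1 + a\<^sup>2 / 8)) \<le> Kg * norm (a ^ 4)"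
    using eventually_at_right_0[OF Kg(2)] by blast
  obtain Ki where Ki: "Ki > 0" "eventually (\<lambda>a. norm (I a - a\<^sup>2 / 2) \<le> Ki * norm (a ^ 4)) (at_right 0)"
    using i by (rule landau_o.bigE)
  obtain bi where bi: "bi > 0" "\<And>a. 0 < a \<Longrightarrow> a < bi \<Longrightarrow> norm (I a - a\<^sup>2 / 2) \<le> Ki * norm (a ^ 4)"
    using eventually_at_right_0[OF Ki(2)] by blast
  \<comment> \<open>The 1 absorbs the term \<open>a\<^sup>2 / 8\<close> of \<open>\<gamma>\<close>;
    \<open>2 * Ki\<close> matches the factor 1/2 in the bound on \<open>I\<close>.\<close>
  define K where "K = 1 + Kg + 2 * Ki"
  have K: "K \<ge> 1" using Kg Ki by (simp add: K_def)
  define b where "b = min (min a0 (1 / (100 * K))) (min bg bi)"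
  have b: "b > 0" "b \<le> a0" "b \<le> 1 / (100 * K)" "b \<le> bg" "b \<le> bi"
    using a0 K bg bi by (auto simp: b_def)
  define m where "m = (\<lambda>a. sqrt ((\<gamma> a)\<^sup>2 - 2 * I a))"
  define e where "e = (\<lambda>a. sqrt (2 * (\<gamma> a - m a)))"
  \<comment> \<open>The endpoints from \<open>delta2_coercive\<close>. They depend on
    \<open>a\<close> alone, so one interval of speeds serves every number of periods
    \<open>N\<close>.\<close>
  define cm where "cm = (\<lambda>a. 2 * m a * (m a - e a * (1 - 24 * e a)))"
  define cp where "cp = (\<lambda>a. 2 * m a * (m a + e a * (1 - 24 * e a)))"
  have sm: "\<bar>\<gamma> a - 1\<bar> \<le> K * a\<^sup>2" "\<bar>I a - a\<^sup>2 / 2\<bar> \<le> K * a ^ 4 / 2" "a \<le> 1 / (100 * K)"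
    if a: "0 < a" "a < b" for a
  proof -
    show "a \<le> 1 / (100 * K)" using a b by simp
    also have "1 / (100 * K) \<le> 1" using K by simp
    finally have a1: "a \<le> 1" .
    have "a ^ 4 = a\<^sup>2 * a\<^sup>2" by (simp add: power2_eq_square power4_eq_xxxx)
    moreover have "a\<^sup>2 \<le> 1" using a a1 by (simp add: power_le_one)
    ultimately have "a ^ 4 \<le> a\<^sup>2" using mult_left_le[of "a\<^sup>2" "a\<^sup>2"] by simp
    then have "Kg * a ^ 4 \<le> Kg * a\<^sup>2" using Kg by simp
    moreover have "\<bar>\<gamma> a - (1 + a\<^sup>2 / 8)\<bar> \<le> Kg * a ^ 4" using bg(2)[of a] a b by simp
    moreover have "K * a\<^sup>2 = a\<^sup>2 + Kg * a\<^sup>2 + 2 * Ki * a\<^sup>2" by (simp add: K_def algebra_simps)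
    moreover have "0 \<le> Ki * a\<^sup>2" "0 \<le> a\<^sup>2" using Ki by auto
    ultimately show "\<bar>\<gamma> a - 1\<bar> \<le> K * a\<^sup>2" by linarith
    have "\<bar>I a - a\<^sup>2 / 2\<bar> \<le> Ki * a ^ 4" using bi(2)[of a] a b by simp
    also have "\<dots> \<le> (K / 2) * a ^ 4" using Kg by (intro mult_right_mono) (auto simp: K_def)
    finally show "\<bar>I a - a\<^sup>2 / 2\<bar> \<le> K * a ^ 4 / 2" by simp
  qed
  have fold: "sqrt ((\<gamma> a)\<^sup>2 - 2 * I a) = m a" "sqrt (2 * (\<gamma> a - m a)) = e a" for a
    by (simp_all add: m_def e_def)
  note sp = small_amplitude_parameters[OF K _ sm(3) sm(1) sm(2), unfolded fold]
  have ev: "eventually (\<lambda>a. a \<in> {0<..<b}) (at_right 0)"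
    using b(1) by (simp add: eventually_at_right_field) (metis)
  have Om: "(\<lambda>a. cm a - (2 - 2 * a)) \<in> O[at_right 0](\<lambda>a. a\<^sup>2)"
  proof (rule bigoI)
    show "eventually (\<lambda>a. norm (cm a - (2 - 2 * a)) \<le> 500 * K * norm (a\<^sup>2)) (at_right 0)"
      using ev by eventually_elim (use sp(9) in \<open>auto simp: cm_def\<close>)
  qed
  have Op: "(\<lambda>a. cp a - (2 + 2 * a)) \<in> O[at_right 0](\<lambda>a. a\<^sup>2)"
  proof (rule bigoI)
    show "eventually (\<lambda>a. norm (cp a - (2 + 2 * a)) \<le> 500 * K * norm (a\<^sup>2)) (at_right 0)"
      using ev by eventually_elim (use sp(8) in \<open>auto simp: cp_def\<close>)
  qed
  define a3 where "a3 = b / 2"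
  have a3: "0 < a3" "a3 < b" "a3 \<in> {0<..<a0}" using b by (auto simp: a3_def)
  \<comment> \<open>The cap 9/8 is below \<open>pi\<^sup>2 / 8\<close> because
    \<open>pi > 3\<close>; the other bound keeps the amplitude below \<open>a3\<close>.\<close>
  define \<gamma>0 where "\<gamma>0 = min (\<gamma> a3) (9/8)"
  have \<gamma>a3: "1 < \<gamma> a3" "\<gamma> a3 < \<gamma>1" using a3(3) \<gamma>1 by auto
  have "\<gamma>0 > 1" using \<gamma>a3 by (simp add: \<gamma>0_def)
  moreover have "\<gamma>0 < pi\<^sup>2 / 8"
  proof -
    have "(3::real)\<^sup>2 < pi\<^sup>2" using pi_gt3 by (intro power_strict_mono) auto
    then show ?thesis by (simp add: \<gamma>0_def)
  qed
  moreover have "\<exists>a\<in>{0<..<a0}. \<gamma> a = g \<and>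
       (\<forall>N::nat. N \<ge> 1 \<longrightarrow>
         (\<exists>C>0. \<forall>c\<in>{cm a<..<cp a}. \<forall>v\<in>H1_per_zero (2 * pi * real N).
            L2_inner (2 * pi * real N) (deriv (U a)) v = 0 \<longrightarrow>
            delta2_Lambda (2 * pi * real N) c (\<gamma> a) (I a) (U a) v
              \<ge> C * (H1_norm (2 * pi * real N) v)\<^sup>2))" if gg: "g \<in> {1<..<\<gamma>0}" for g
  proof -
    have "g \<in> \<gamma> ` {0<..<a0}" using gg \<gamma>a3 unfolding \<gamma>1 by (auto simp: \<gamma>0_def)
    then obtain a where a: "a \<in> {0<..<a0}" "\<gamma> a = g" by auto
    \<comment> \<open>Strict monotonicity of \<open>\<gamma>\<close> converts smallness of
      \<open>g - 1\<close> into smallness of \<open>a\<close>, where the explicit estimates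
      hold.\<close>
    have "a < a3"
    proof (rule ccontr)
      assume "\<not> a < a3"
      then have "\<gamma> a3 \<le> \<gamma> a" using strict_mono_onD[OF mono a3(3) a(1)] by (cases "a = a3") auto
      then show False using gg a by (simp add: \<gamma>0_def)
    qed
    then have ab: "0 < a" "a < b" using a a3 by auto
    interpret w: wave "\<gamma> a" "I a" "U a"
      using wave[OF a(1)] sp(1,2)[OF ab(1) ab ab ab] by unfold_locales
    have meq: "w.m = m a" by (simp add: w.m_def m_def)
    have "\<exists>C>0. \<forall>c\<in>{cm a<..<cp a}. \<forall>v\<in>H1_per_zero (2 * pi * real N).
            L2_inner (2 * pi * real N) (deriv (U a)) v = 0 \<longrightarrow>
            delta2_Lambda (2 * pi * real N) c (\<gamma> a) (I a) (U a) v
              \<ge> C * (H1_norm (2 * pi * real N) v)\<^sup>2" if "N \<ge> 1" for N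
      using w.delta2_coercive[OF _ _ that] sp(6,7)[OF ab(1) ab ab ab] unfolding meq fold cm_def cp_def by blast
    then show ?thesis using a by blast
  qed
  ultimately show ?thesis using Om Op by blast
qed

end
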